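(* Let $n$ be a positive integer, let $h_1,\ldots,h_n$ be non-negative integers with sum $H:=h_1+\ldots+h_n$, let $K$ be a differential field of characteristic zero, and let $A$ be a (commutative, associative, unital) differential $K$-algebra. Then for all ideals (not necessarily differential) $I_1,\ldots,I_n$ of $A$, $$\left(I_1^{(h_1)}\cap\ldots\cap I_n^{(h_n)}\right)^{n\max_{1\leqslant i\leqslant n}(h_i+1)(H-h_i)+n}\subset\left(I_1\cap\ldots\cap I_n\right)^{(h_1+\ldots+h_n)}.$$
   Context: A differential ring is a ring with a derivation; a differential $K$-algebra over a differential field $K$ is a differential ring $A$ that is a $K$-algebra and whose derivation restricts to the derivation of $K$. For an ideal $I$ of a differential ring and $h\in\mathbb{Z}_{\geqslant 0}$, $I^{(h)}$ denotes the ideal generated by all derivatives of order at most $h$ (including order $0$) of elements of $I$. The exponent means $n\cdot\left(\max_i(h_i+1)(H-h_i)\right)+n$ and denotes an ordinary power of an ideal. *)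

theory Defs
  imports "HOL-Algebra.Algebra"
begin

locale differential_ring = ring R for R (structure) +
  fixes D :: "'a \<Rightarrow> 'a"
  assumes D_closed: "x \<in> carrier R \<Longrightarrow> D x \<in> carrier R"
    and D_add: "\<lbrakk>x \<in> carrier R; y \<in> carrier R\<rbrakk> \<Longrightarrow> D (x \<oplus> y) = D x \<oplus> D y"
    and D_mult: "\<lbrakk>x \<in> carrier R; y \<in> carrier R\<rbrakk> \<Longrightarrow> D (x \<otimes> y) = D x \<otimes> y \<oplus> x \<otimes> D y"

locale differential_field = field R + differential_ring R D
  for R (structure) and D

definition char_zero :: "('a, 'm) ring_scheme \<Rightarrow> bool" where
  "char_zero R \<longleftrightarrow> (\<forall>m::nat. 0 < m \<longrightarrow> [m] \<cdot>\<^bsub>R\<^esub> \<one>\<^bsub>R\<^esub> \<noteq> \<zero>\<^bsub>R\<^esub>)"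

text \<open>The structure map of the algebra sends \<open>c\<close> to \<open>c \<odot> \<one>\<close>; that the derivation of \<open>A\<close>
  restricts to the one of \<open>K\<close> means that this map commutes with the derivations. The zero
  algebra is allowed.\<close>

locale differential_algebra =
  base: differential_field K dK + differential_ring A dA + algebra K A
  for K :: "('k, 'm) ring_scheme" and dK :: "'k \<Rightarrow> 'k"
    and A :: "('k, 'a, 'n) module_scheme" and dA :: "'a \<Rightarrow> 'a" +
  assumes D_restrict: "c \<in> carrier K \<Longrightarrow> dA (c \<odot>\<^bsub>A\<^esub> \<one>\<^bsub>A\<^esub>) = dK c \<odot>\<^bsub>A\<^esub> \<one>\<^bsub>A\<^esub>"

definition deriv_ideal ::
    "('a, 'm) ring_scheme \<Rightarrow> ('a \<Rightarrow> 'a) \<Rightarrow> 'a set \<Rightarrow> nat \<Rightarrow> 'a set" where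
  "deriv_ideal R D I h = genideal R {(D ^^ k) x | k x. k \<le> h \<and> x \<in> I}"

text \<open>Powers of ideals are taken in the multiplicative monoid of \<^const>\<open>ideals_set\<close>, whose
  product is \<^const>\<open>ideal_prod\<close> and whose unit is the whole ring.\<close>

lemma ideals_set_pow:
  "I [^]\<^bsub>ideals_set R\<^esub> (0::nat) = carrier R"
  "I [^]\<^bsub>ideals_set R\<^esub> Suc m = ideal_prod R (I [^]\<^bsub>ideals_set R\<^esub> m) I"
  by (simp_all add: nat_pow_def ideals_set_def)

end

theory Submission
  imports Defs "HOL-Library.Poly_Mapping" "HOL-Computational_Algebra.Formal_Power_Series"
begin

text \<open>With \<open>X_i = \<Sum>\<^sub>j x\<^sub>i\<^sub>j t ^ j\<close> for \<open>x\<^sub>i\<^sub>j\<close> the \<open>j\<close>-th divided derivative of an element of the \<open>i\<close>-th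
  ideal, the divided derivatives up to order \<open>H\<close> of a product are the first \<open>H + 1\<close> coefficients
  of \<open>\<Prod>X_i\<close>. After polarization it suffices to show that in the generic situation
  \<open>\<Prod>x\<^sub>i\<^sub>h ^ d\<close>, with \<open>h = h_i\<close> and \<open>d > (h_i + 1) (H - h_i)\<close>, lies in the ideal \<open>F\<close> of these
  coefficients.

  A polynomial lies in \<open>F\<close> if it vanishes under all substitutions \<open>X_i = w_i U_i\<close>, where
  \<open>w_1 \<cdots> w_n = t ^ (H + 1)\<close> is the universal factorization into monic polynomials of given
  degrees; its coefficients generate the cohomology ring of a partial flag variety. This is shown
  by induction on \<open>H\<close>, splitting off one constant coefficient \<open>x\<^sub>i\<^sub>0\<close> after the other.
  Under such a substitution some \<open>w_i\<close> has degree \<open>p > h_i\<close>, so that \<open>x\<^sub>i\<^sub>h\<close> becomes a combination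
  of classes of degree at least \<open>p - h_i\<close> from a Grassmannian of dimension \<open>p (H + 1 - p)\<close>, and
  \<open>d (p - h_i) > p (H + 1 - p)\<close>.\<close>

section \<open>Integer polynomials and their universal property\<close>

type_synonym 'v zpoly = "('v \<Rightarrow>\<^sub>0 nat) \<Rightarrow>\<^sub>0 int"

definition zvar :: "'v \<Rightarrow> 'v zpoly" where
  "zvar v = Poly_Mapping.single (Poly_Mapping.single v 1) 1"

lemma zmonom_induct:
  fixes P :: "'v zpoly \<Rightarrow> bool"
  assumes "P 1" "\<And>v. P (zvar v)" "\<And>a b. P a \<Longrightarrow> P b \<Longrightarrow> P (a * b)"
  shows "P (Poly_Mapping.single m 1)"
proof (induction m rule: update_induct)
  case const
  then show ?case using assms(1) by (simp add: single_one)
next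
  case (update f a b)
  have pow: "P (Poly_Mapping.single (Poly_Mapping.single a k) 1)" for k
  proof (induction k)
    case 0
    then show ?case using assms(1) by (simp add: single_one)
  next
    case (Suc k)
    have "Poly_Mapping.single (Poly_Mapping.single a (Suc k)) (1::int)
        = Poly_Mapping.single (Poly_Mapping.single a k) 1 * zvar a"
      by (simp add: zvar_def mult_single flip: single_add)
    with Suc assms(2,3) show ?case by metis
  qed
  have "Poly_Mapping.update a b f = Poly_Mapping.single a b + f"
    using update by (intro poly_mapping_eqI)
      (auto simp: lookup_update lookup_add lookup_single when_def in_keys_iff)
  then have "Poly_Mapping.single (Poly_Mapping.update a b f) (1::int)
      = Poly_Mapping.single (Poly_Mapping.single a b) 1 * Poly_Mapping.single f 1"
    by (simp add: mult_single)
  with pow update.IH assms(3) show ?case by metis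
qed

text \<open>Integer polynomials form the free abelian group on the monomials, so
  \<open>frag_induction\<close> leaves only monomials to treat. Differences cover sums and negatives
  at once, and zero arises as \<open>1 - 1\<close>.\<close>

lemma zpoly_induct [case_names one var diff mult]:
  fixes P :: "'v zpoly \<Rightarrow> bool"
  assumes "P 1" "\<And>v. P (zvar v)"
    and diff: "\<And>a b. P a \<Longrightarrow> P b \<Longrightarrow> P (a - b)" and "\<And>a b. P a \<Longrightarrow> P b \<Longrightarrow> P (a * b)"
  shows "P p"
proof (induction p rule: frag_induction[OF subset_UNIV, consumes 0, case_names zero one diff])
  case zero
  show ?case using diff[OF assms(1) assms(1)] by simp
next
  case (one x)
  show ?case using zmonom_induct[of P] assms by blast
qed (use diff in auto)

section \<open>Evaluation of integer polynomials in a commutative ring with carrier\<close>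

context cring
begin

definition monom_eval :: "('v \<Rightarrow> 'a) \<Rightarrow> ('v \<Rightarrow>\<^sub>0 nat) \<Rightarrow> 'a" where
  "monom_eval \<phi> m = (\<Otimes>v\<in>Poly_Mapping.keys m. \<phi> v [^] Poly_Mapping.lookup m v)"

definition poly_eval :: "('v \<Rightarrow> 'a) \<Rightarrow> 'v zpoly \<Rightarrow> 'a" where
  "poly_eval \<phi> p = (\<Oplus>m\<in>Poly_Mapping.keys p. [Poly_Mapping.lookup p m] \<cdot> monom_eval \<phi> m)"

context
  fixes \<phi> :: "'v \<Rightarrow> 'a"
  assumes \<phi>: "\<And>v. \<phi> v \<in> carrier R"
begin

lemma monom_eval_closed [simp]: "monom_eval \<phi> m \<in> carrier R"
  unfolding monom_eval_def using \<phi> by (auto intro!: finprod_closed)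

lemma poly_eval_closed [simp]: "poly_eval \<phi> p \<in> carrier R"
  unfolding poly_eval_def by (auto intro!: finsum_closed)

lemma monom_eval_superset:
  assumes "finite S" "Poly_Mapping.keys m \<subseteq> S"
  shows "monom_eval \<phi> m = (\<Otimes>v\<in>S. \<phi> v [^] Poly_Mapping.lookup m v)"
  unfolding monom_eval_def using assms \<phi>
  by (intro finprod_mono_neutral_cong_left) (auto simp: in_keys_iff)

lemma poly_eval_superset:
  assumes "finite S" "Poly_Mapping.keys p \<subseteq> S"
  shows "poly_eval \<phi> p = (\<Oplus>m\<in>S. [Poly_Mapping.lookup p m] \<cdot> monom_eval \<phi> m)"
  unfolding poly_eval_def using assms
  by (intro add.finprod_mono_neutral_cong_left) (auto simp: in_keys_iff int_pow_0[of "add_monoid R", folded add_pow_def, simplified])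

lemma monom_eval_add: "monom_eval \<phi> (m + m') = monom_eval \<phi> m \<otimes> monom_eval \<phi> m'"
proof -
  define S where "S = Poly_Mapping.keys m \<union> Poly_Mapping.keys m'"
  have S: "finite S" "Poly_Mapping.keys (m + m') \<subseteq> S" "Poly_Mapping.keys m \<subseteq> S"
      "Poly_Mapping.keys m' \<subseteq> S"
    unfolding S_def using keys_add[of m m'] by auto
  show ?thesis
    using S \<phi> by (simp add: monom_eval_superset[of S] lookup_add nat_pow_mult
        flip: finprod_multf cong: finprod_cong)
qed

lemma poly_eval_add: "poly_eval \<phi> (p + q) = poly_eval \<phi> p \<oplus> poly_eval \<phi> q"
proof -
  define S where "S = Poly_Mapping.keys p \<union> Poly_Mapping.keys q"
  have S: "finite S" "Poly_Mapping.keys (p + q) \<subseteq> S" "Poly_Mapping.keys p \<subseteq> S"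
      "Poly_Mapping.keys q \<subseteq> S"
    unfolding S_def using keys_add[of p q] by auto
  show ?thesis
    using S by (simp add: poly_eval_superset[of S] lookup_add add.int_pow_mult
        flip: finsum_addf cong: finsum_cong)
qed

lemma poly_eval_0 [simp]: "poly_eval \<phi> 0 = \<zero>"
  by (simp add: poly_eval_def)

lemma poly_eval_diff: "poly_eval \<phi> (p - q) = poly_eval \<phi> p \<ominus> poly_eval \<phi> q"
proof -
  have "poly_eval \<phi> p = poly_eval \<phi> (p - q) \<oplus> poly_eval \<phi> q"
    by (simp flip: poly_eval_add)
  then show ?thesis by (simp add: minus_eq a_assoc r_neg)
qed

lemma poly_eval_monom: "poly_eval \<phi> (Poly_Mapping.single m 1) = monom_eval \<phi> m"
  by (simp add: poly_eval_def)

lemma poly_eval_1 [simp]: "poly_eval \<phi> 1 = \<one>"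
  unfolding single_one[symmetric] poly_eval_monom by (simp add: monom_eval_def)

lemma poly_eval_zvar [simp]: "poly_eval \<phi> (zvar v) = \<phi> v"
  unfolding zvar_def poly_eval_monom using \<phi> by (simp add: monom_eval_def)

lemma poly_eval_mult: "poly_eval \<phi> (p * q) = poly_eval \<phi> p \<otimes> poly_eval \<phi> q"
proof (induction p rule: frag_induction[OF subset_UNIV, consumes 0, case_names zero one diff])
  case (one m)
  show ?case
  proof (induction q rule: frag_induction[OF subset_UNIV, consumes 0, case_names zero one diff])
    case (one m')
    then show ?case by (simp add: mult_single poly_eval_monom monom_eval_add)
  next
    case (diff a b)
    then show ?case by (simp add: right_diff_distrib poly_eval_diff r_distr r_minus minus_eq)
  qed auto
next
  case (diff a b)
  then show ?case by (simp add: left_diff_distrib poly_eval_diff l_distr l_minus minus_eq)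
qed auto

lemma poly_eval_sum: "poly_eval \<phi> (\<Sum>i\<in>A. f i) = (\<Oplus>i\<in>A. poly_eval \<phi> (f i))"
  by (induction A rule: infinite_finite_induct) (simp_all add: poly_eval_add)

lemma poly_eval_prod: "poly_eval \<phi> (\<Prod>i\<in>A. f i) = (\<Otimes>i\<in>A. poly_eval \<phi> (f i))"
  by (induction A rule: infinite_finite_induct) (simp_all add: poly_eval_mult)

lemma poly_eval_of_nat: "poly_eval \<phi> (of_nat c) = [c] \<cdot> \<one>"
  by (induction c) (simp_all add: poly_eval_add a_comm)

end

end

text \<open>The algebra of the theorem has an explicit carrier, whereas the generic computations
  live in type-class rings. Viewing the latter as carrier rings lets one evaluation map serve
  both.\<close>

definition type_ring :: "'r::comm_ring_1 ring" where
  "type_ring = \<lparr>carrier = UNIV, monoid.mult = (*), monoid.one = 1, ring.zero = 0, ring.add = (+)\<rparr>"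

interpretation type_ring: cring "type_ring :: 'r::comm_ring_1 ring"
proof (intro cringI abelian_groupI comm_monoidI)
  show "\<exists>y\<in>carrier type_ring. y \<oplus>\<^bsub>type_ring\<^esub> x = \<zero>\<^bsub>type_ring\<^esub>" for x :: 'r
    by (auto simp: type_ring_def intro: exI[of _ "- x"])
qed (auto simp: type_ring_def algebra_simps)

definition subst :: "('v \<Rightarrow> 'r::comm_ring_1) \<Rightarrow> 'v zpoly \<Rightarrow> 'r" where
  "subst \<phi> = cring.poly_eval type_ring \<phi>"

lemma subst_in_type_ring: "x \<in> carrier type_ring"
  by (simp add: type_ring_def)

lemma subst_add: "subst \<phi> (p + q) = subst \<phi> p + subst \<phi> q"
  using type_ring.poly_eval_add[of \<phi>, OF subst_in_type_ring]
  by (simp add: subst_def) (simp add: type_ring_def)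

lemma subst_mult: "subst \<phi> (p * q) = subst \<phi> p * subst \<phi> q"
  using type_ring.poly_eval_mult[of \<phi>, OF subst_in_type_ring]
  by (simp add: subst_def) (simp add: type_ring_def)

lemma subst_0 [simp]: "subst \<phi> 0 = 0"
  using type_ring.poly_eval_0[of \<phi>, OF subst_in_type_ring]
  by (simp add: subst_def) (simp add: type_ring_def)

lemma subst_1 [simp]: "subst \<phi> 1 = 1"
  using type_ring.poly_eval_1[of \<phi>, OF subst_in_type_ring]
  by (simp add: subst_def) (simp add: type_ring_def)

lemma subst_zvar [simp]: "subst \<phi> (zvar v) = \<phi> v"
  using type_ring.poly_eval_zvar[of \<phi>, OF subst_in_type_ring] by (simp add: subst_def)

lemma subst_diff: "subst \<phi> (p - q) = subst \<phi> p - subst \<phi> q"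
  using subst_add[of \<phi> "p - q" q] by simp

lemma subst_uminus: "subst \<phi> (- p) = - subst \<phi> p"
  using subst_diff[of \<phi> 0 p] by simp

lemma subst_sum: "subst \<phi> (\<Sum>i\<in>A. f i) = (\<Sum>i\<in>A. subst \<phi> (f i))"
  by (induction A rule: infinite_finite_induct) (simp_all add: subst_add)

lemma subst_prod: "subst \<phi> (\<Prod>i\<in>A. f i) = (\<Prod>i\<in>A. subst \<phi> (f i))"
  by (induction A rule: infinite_finite_induct) (simp_all add: subst_mult)

lemma subst_power: "subst \<phi> (p ^ k) = subst \<phi> p ^ k"
  by (induction k) (simp_all add: subst_mult)

lemma subst_of_nat [simp]: "subst \<phi> (of_nat c) = of_nat c"
  by (induction c) (simp_all add: subst_add)

lemma subst_of_int [simp]: "subst \<phi> (of_int c) = of_int c"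
  by (cases c) (simp_all add: subst_diff subst_uminus)

lemma subst_subst: "subst \<phi> (subst \<psi> p) = subst (\<lambda>v. subst \<phi> (\<psi> v)) p"
  by (induction p rule: zpoly_induct) (simp_all add: subst_diff subst_mult)

lemma subst_id: "subst zvar p = p"
  by (induction p rule: zpoly_induct) (simp_all add: subst_diff subst_mult)

section \<open>Coefficientwise substitution in power series\<close>

definition subst_fps :: "('v \<Rightarrow> 'r::comm_ring_1) \<Rightarrow> 'v zpoly fps \<Rightarrow> 'r fps" where
  "subst_fps \<phi> F = Abs_fps (\<lambda>k. subst \<phi> (fps_nth F k))"

lemma subst_fps_nth [simp]: "fps_nth (subst_fps \<phi> F) k = subst \<phi> (fps_nth F k)"
  by (simp add: subst_fps_def)

lemma subst_fps_1 [simp]: "subst_fps \<phi> 1 = 1"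
  by (simp add: fps_eq_iff)

lemma subst_fps_add: "subst_fps \<phi> (F + G) = subst_fps \<phi> F + subst_fps \<phi> G"
  by (simp add: fps_eq_iff subst_add)

lemma subst_fps_mult: "subst_fps \<phi> (F * G) = subst_fps \<phi> F * subst_fps \<phi> G"
  by (simp add: fps_eq_iff fps_mult_nth subst_sum subst_mult)

lemma subst_fps_prod: "subst_fps \<phi> (\<Prod>i\<in>A. F i) = (\<Prod>i\<in>A. subst_fps \<phi> (F i))"
  by (induction A rule: infinite_finite_induct) (simp_all add: subst_fps_mult)

lemma subst_fps_X [simp]: "subst_fps \<phi> fps_X = fps_X"
  by (auto simp: fps_eq_iff fps_X_def)

lemma subst_fps_const [simp]: "subst_fps \<phi> (fps_const c) = fps_const (subst \<phi> c)"
  by (auto simp: fps_eq_iff)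

text \<open>With the ring as a module over itself, \<open>rmod.span\<close> is the ideal generated
  by a set and \<open>rmod.subspace\<close> says that a set is an ideal.\<close>

interpretation rmod: Modules.module "(*) :: 'r::comm_ring_1 \<Rightarrow> 'r \<Rightarrow> 'r"
  by unfold_locales (simp_all add: algebra_simps)

text \<open>This interpreted simplification rule is associativity in the direction opposite to
  \<open>mult.assoc\<close>.\<close>
declare rmod.scale_scale [simp del]

section \<open>Alternants and roots\<close>

lemma subst_monom:
  "subst \<phi> (Poly_Mapping.single m 1) = (\<Prod>v\<in>Poly_Mapping.keys m. \<phi> v ^ Poly_Mapping.lookup m v)"
proof -
  have pow: "x [^]\<^bsub>type_ring\<^esub> k = x ^ k" for x :: 'a and k :: nat
    by (induction k) (simp_all add: type_ring_def mult.commute)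
  have "finprod type_ring f A = prod f A" if "finite A" for f :: "'b \<Rightarrow> 'a" and A
    using that
  proof induction
    case (insert v A)
    then show ?case
      using type_ring.finprod_insert[of A v f] by (simp add: type_ring_def)
  next
    case empty
    show ?case using type_ring.finprod_empty[of f] by (simp add: type_ring_def)
  qed
  then show ?thesis
    using type_ring.poly_eval_monom[of \<phi> m, OF subst_in_type_ring]
    by (simp add: subst_def type_ring.monom_eval_def pow)
qed

lemma zvar_power: "zvar v ^ k = Poly_Mapping.single (Poly_Mapping.single v k) 1"
  by (induction k) (simp_all add: zvar_def mult_single flip: single_add)

lemma prod_monom:
  "(\<Prod>i\<in>A. Poly_Mapping.single (f i) (1::int)) = Poly_Mapping.single (\<Sum>i\<in>A. f i :: 'v \<Rightarrow>\<^sub>0 nat) 1"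
  by (induction A rule: infinite_finite_induct) (simp_all add: mult_single)

lemma lookup_monom_mult:
  fixes y :: "'v zpoly"
  shows "Poly_Mapping.lookup (Poly_Mapping.single \<mu> 1 * y) (\<mu> + \<kappa>) = Poly_Mapping.lookup y \<kappa>"
proof (induction y rule: frag_induction[OF subset_UNIV, consumes 0, case_names zero one diff])
  case (one m)
  show ?case by (simp add: mult_single lookup_single)
qed (simp_all add: right_diff_distrib lookup_minus)

text \<open>If \<open>U\<close> is stable under adding exponents, this is a monomial ideal. Degree
  bounds and the absence of a variable are expressed in the same form.\<close>

definition supp_in :: "(('v \<Rightarrow>\<^sub>0 nat) \<Rightarrow> bool) \<Rightarrow> 'v zpoly set" where
  "supp_in U = {p. \<forall>\<kappa>\<in>Poly_Mapping.keys p. U \<kappa>}"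

lemma supp_inD: "p \<in> supp_in U \<Longrightarrow> \<kappa> \<in> Poly_Mapping.keys p \<Longrightarrow> U \<kappa>"
  by (auto simp: supp_in_def)

lemma supp_in_0 [simp]: "0 \<in> supp_in U"
  by (simp add: supp_in_def)

lemma supp_in_add: "p \<in> supp_in U \<Longrightarrow> q \<in> supp_in U \<Longrightarrow> p + q \<in> supp_in U"
  using keys_add[of p q] by (auto simp: supp_in_def)

lemma supp_in_diff: "p \<in> supp_in U \<Longrightarrow> q \<in> supp_in U \<Longrightarrow> p - q \<in> supp_in U"
  using keys_diff[of p q] by (auto simp: supp_in_def)

lemma supp_in_sum: "(\<And>i. i \<in> A \<Longrightarrow> f i \<in> supp_in U) \<Longrightarrow> sum f A \<in> supp_in U"
  by (induction A rule: infinite_finite_induct) (auto intro: supp_in_add)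

lemma supp_in_mult:
  assumes "p \<in> supp_in U" "q \<in> supp_in V" "\<And>a b. U a \<Longrightarrow> V b \<Longrightarrow> W (a + b)"
  shows "p * q \<in> supp_in W"
  using assms keys_mult[of p q] unfolding supp_in_def by fastforce

lemma supp_in_mult_left:
  assumes "q \<in> supp_in U" "\<And>a b. U b \<Longrightarrow> U (a + b)"
  shows "p * q \<in> supp_in U"
  by (rule supp_in_mult[of p "\<lambda>_. True" _ U]) (use assms in \<open>auto simp: supp_in_def\<close>)

lemma supp_in_mono: "p \<in> supp_in U \<Longrightarrow> (\<And>\<kappa>. U \<kappa> \<Longrightarrow> V \<kappa>) \<Longrightarrow> p \<in> supp_in V"
  by (auto simp: supp_in_def)

lemma supp_in_monom: "U \<mu> \<Longrightarrow> Poly_Mapping.single \<mu> c \<in> supp_in U"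
  by (auto simp: supp_in_def)

text \<open>Multiplication by a monomial translates exponents without any cancellation, so it can be
  undone on supports.\<close>

lemma supp_in_monom_multD:
  assumes "Poly_Mapping.single \<mu> 1 * y \<in> supp_in U"
  shows "y \<in> supp_in (\<lambda>\<kappa>. U (\<mu> + \<kappa>))"
  using assms by (auto simp: supp_in_def in_keys_iff lookup_monom_mult)

text \<open>In polynomials with variables from \<^typ>\<open>'w + nat\<close> the right-hand variables play the role
  of Chern roots. Modulo \<open>root_ideal m\<close>, multiplication by the alternant has as kernel the ideal
  of relations in the cohomology of the variety of complete flags.\<close>

definition rvar :: "nat \<Rightarrow> ('w + nat) zpoly" where
  "rvar k = zvar (Inr k)"

abbreviation rexp :: "('w + nat \<Rightarrow>\<^sub>0 nat) \<Rightarrow> nat \<Rightarrow> nat" where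
  "rexp \<kappa> k \<equiv> Poly_Mapping.lookup \<kappa> (Inr k)"

text \<open>The ideal generated by \<open>rvar k ^ m\<close> for \<open>k < m\<close>: the relations
  in the cohomology of a product of \<open>m\<close> projective spaces of dimension
  \<open>m - 1\<close>.\<close>

definition root_ideal :: "nat \<Rightarrow> ('w + nat) zpoly set" where
  "root_ideal m = supp_in (\<lambda>\<kappa>. \<exists>k<m. m \<le> rexp \<kappa> k)"

lemma root_ideal_add: "p \<in> root_ideal m \<Longrightarrow> q \<in> root_ideal m \<Longrightarrow> p + q \<in> root_ideal m"
  unfolding root_ideal_def by (rule supp_in_add)

lemma root_ideal_mult: "q \<in> root_ideal m \<Longrightarrow> p * q \<in> root_ideal m"
  unfolding root_ideal_def by (erule supp_in_mult_left) (auto simp: lookup_add intro: trans_le_add2)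

text \<open>The Vandermonde determinant of the roots in its Leibniz expansion.\<close>

definition alternant :: "nat \<Rightarrow> ('w + nat) zpoly" where
  "alternant m = (\<Sum>\<pi> | \<pi> permutes {..<m}. of_int (sign \<pi>) * (\<Prod>k<m. rvar k ^ \<pi> k))"

lemma root_prod_monom:
  "(\<Prod>k\<in>K. rvar k ^ e k) = Poly_Mapping.single (\<Sum>k\<in>K. Poly_Mapping.single (Inr k) (e k)) 1"
  by (simp add: rvar_def zvar_power prod_monom)

lemma rexp_sum:
  "finite K \<Longrightarrow> rexp (\<Sum>k\<in>K. Poly_Mapping.single (Inr k) (e k)) l = (if l \<in> K then e l else 0)"
  by (simp add: lookup_sum lookup_single when_def)

lemma rexp_alternant:
  "alternant m \<in> supp_in (\<lambda>\<kappa>. \<exists>\<pi>. \<pi> permutes {..<m} \<and> (\<forall>k. rexp \<kappa> k = (if k < m then \<pi> k else 0)))"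
  unfolding alternant_def
proof (rule supp_in_sum)
  fix \<pi> assume "\<pi> \<in> {\<pi>. \<pi> permutes {..<m}}"
  then show "of_int (sign \<pi>) * (\<Prod>k<m. rvar k ^ \<pi> k) \<in> supp_in
      (\<lambda>\<kappa>. \<exists>\<pi>. \<pi> permutes {..<m} \<and> (\<forall>k. rexp \<kappa> k = (if k < m then \<pi> k else 0)))"
    unfolding root_prod_monom
    by (intro supp_in_mult[where U = "\<lambda>\<kappa>. \<kappa> = 0" and V = "\<lambda>\<kappa>. \<kappa> = (\<Sum>k<m. Poly_Mapping.single (Inr k) (\<pi> k))"]
        supp_in_monom)
      (auto simp: rexp_sum supp_in_def lookup_of_int in_keys_iff when_def split: if_splits)
qed

section \<open>Permutations of the roots and antisymmetry\<close>

definition rename :: "(nat \<Rightarrow> nat) \<Rightarrow> ('w + nat) zpoly \<Rightarrow> ('w + nat) zpoly" where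
  "rename \<tau> = subst (case_sum (\<lambda>w. zvar (Inl w)) (\<lambda>k. rvar (\<tau> k)))"

lemma rename_rvar [simp]: "rename \<tau> (rvar k) = rvar (\<tau> k)"
  by (simp add: rename_def rvar_def)

lemma rename_mult: "rename \<tau> (p * q) = rename \<tau> p * rename \<tau> q"
  by (simp add: rename_def subst_mult)

lemma rename_power: "rename \<tau> (p ^ k) = rename \<tau> p ^ k"
  by (simp add: rename_def subst_power)

text \<open>A bijective renaming permutes the monomials, so no two terms merge and coefficients are
  found by pulling back the exponents.\<close>

lemma lookup_rename:
  fixes p :: "('w + nat) zpoly"
  assumes "bij \<tau>"
  shows "Poly_Mapping.lookup (rename \<tau> p) \<kappa> = Poly_Mapping.lookup p (Poly_Mapping.map_key (map_sum id \<tau>) \<kappa>)"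
proof -
  have inj: "inj (map_sum id \<tau> :: 'w + nat \<Rightarrow> 'w + nat)"
    using assms by (simp add: sum.inj_map bij_is_inj)
  have L: "Poly_Mapping.lookup (Poly_Mapping.map_key (map_sum id \<tau>) \<kappa>) v = Poly_Mapping.lookup \<kappa> (map_sum id \<tau> v)"
    for \<kappa> :: "'w + nat \<Rightarrow>\<^sub>0 nat" and v
    using inj by (simp add: map_key.rep_eq)
  show ?thesis
  proof (induction p rule: frag_induction[OF subset_UNIV, consumes 0, case_names zero one diff])
    case (one m)
    define m' where "m' = (\<Sum>v\<in>Poly_Mapping.keys m. Poly_Mapping.single (map_sum id \<tau> v) (Poly_Mapping.lookup m v))"
    have "rename \<tau> (Poly_Mapping.single m 1) = (\<Prod>v\<in>Poly_Mapping.keys m. zvar (map_sum id \<tau> v) ^ Poly_Mapping.lookup m v)"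
      unfolding rename_def subst_monom by (intro prod.cong refl) (auto simp: rvar_def split: sum.split)
    also have "\<dots> = Poly_Mapping.single m' 1"
      by (simp add: zvar_power prod_monom m'_def)
    finally have *: "rename \<tau> (Poly_Mapping.single m 1) = Poly_Mapping.single m' 1" .
    have m': "Poly_Mapping.lookup m' (map_sum id \<tau> v) = Poly_Mapping.lookup m v" for v
      using inj by (auto simp: m'_def lookup_sum lookup_single when_def inj_eq in_keys_iff)
    have "m' = \<kappa> \<longleftrightarrow> m = Poly_Mapping.map_key (map_sum id \<tau>) \<kappa>"
    proof
      assume "m' = \<kappa>"
      then show "m = Poly_Mapping.map_key (map_sum id \<tau>) \<kappa>"
        using m' by (intro poly_mapping_eqI) (simp add: L)
    next
      assume m: "m = Poly_Mapping.map_key (map_sum id \<tau>) \<kappa>"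
      show "m' = \<kappa>"
      proof (rule poly_mapping_eqI)
        fix w :: "'w + nat"
        obtain v where "w = map_sum id \<tau> v"
          using assms by (cases w) (metis id_apply map_sum.simps(1), metis bij_pointE map_sum.simps(2))
        then show "Poly_Mapping.lookup m' w = Poly_Mapping.lookup \<kappa> w" using m m' L by simp
      qed
    qed
    then show ?case by (simp only: * lookup_single)
  qed (simp_all add: rename_def subst_diff lookup_minus)
qed

text \<open>Composition with the transposition reindexes the Leibniz sum and flips every
  sign.\<close>

lemma rename_alternant:
  assumes "a < m" "b < m" "a \<noteq> b"
  shows "rename (transpose a b) (alternant m) = - (alternant m :: ('w + nat) zpoly)"
proof -
  let ?t = "transpose a b"
  have t: "?t permutes {..<m}" using assms by (intro permutes_swap_id) auto
  have "rename ?t (alternant m :: ('w + nat) zpoly) = (\<Sum>\<pi> | \<pi> permutes {..<m}. of_int (sign \<pi>) * (\<Prod>k<m. rvar (?t k) ^ \<pi> k))"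
    by (simp add: alternant_def rename_def subst_sum subst_mult subst_prod subst_power rename_rvar[unfolded rename_def])
  also have "\<dots> = (\<Sum>\<pi> | \<pi> permutes {..<m}. of_int (sign \<pi>) * (\<Prod>k<m. rvar k ^ (\<pi> \<circ> ?t) k))"
  proof (intro sum.cong refl)
    fix \<pi> :: "nat \<Rightarrow> nat"
    have "(\<Prod>k<m. rvar (?t k) ^ \<pi> k) = (\<Prod>k<m. (rvar k :: ('w + nat) zpoly) ^ (\<pi> \<circ> ?t) k)"
      using prod.permute[OF t, of "\<lambda>k. (rvar k :: ('w + nat) zpoly) ^ (\<pi> \<circ> ?t) k"]
      by (simp add: o_def)
    then show "of_int (sign \<pi>) * (\<Prod>k<m. rvar (?t k) ^ \<pi> k)
        = of_int (sign \<pi>) * (\<Prod>k<m. (rvar k :: ('w + nat) zpoly) ^ (\<pi> \<circ> ?t) k)"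
      by (simp only:)
  qed
  also have "\<dots> = (\<Sum>\<pi> | \<pi> permutes {..<m}. - (of_int (sign (\<pi> \<circ> ?t)) * (\<Prod>k<m. rvar k ^ (\<pi> \<circ> ?t) k)))"
  proof (intro sum.cong refl)
    fix \<pi> assume "\<pi> \<in> {\<pi>. \<pi> permutes {..<m}}"
    then have "sign (\<pi> \<circ> ?t) = - sign \<pi>"
      using assms by (simp add: sign_compose sign_swap_id permutes_imp_permutation[of "{..<m}"] permutation_swap_id)
    then show "of_int (sign \<pi>) * (\<Prod>k<m. rvar k ^ (\<pi> \<circ> ?t) k)
        = - (of_int (sign (\<pi> \<circ> ?t)) * (\<Prod>k<m. (rvar k :: ('w + nat) zpoly) ^ (\<pi> \<circ> ?t) k))"
      by simp
  qed
  also have "\<dots> = - alternant m"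
    unfolding alternant_def sum_negf
    by (subst (2) sum_permutations_compose_right[OF t]) simp
  finally show ?thesis .
qed

section \<open>Degrees in the roots and vanishing above the dimension\<close>

definition root_degree :: "nat set \<Rightarrow> ('w + nat \<Rightarrow>\<^sub>0 nat) \<Rightarrow> nat" where
  "root_degree K \<kappa> = (\<Sum>k\<in>K. rexp \<kappa> k)"

lemma root_degree_add: "root_degree K (a + b) = root_degree K a + root_degree K b"
  by (simp add: root_degree_def lookup_add sum.distrib)

text \<open>Induction on the largest element, which is at least the number of the others because
  these are distinct and below it.\<close>

lemma sum_lessThan_card_le:
  fixes A :: "nat set"
  assumes "finite A"
  shows "\<Sum>{..<card A} \<le> \<Sum>A"
  using assms
proof (induction A rule: finite_linorder_max_induct)
  case (insert b A)
  then have "card A \<le> card {..<b}" by (intro card_mono) auto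
  with insert show ?case by (subst card_insert_disjoint sum.insert, auto)+
qed simp

text \<open>The upper bound is the lower bound applied to the reflected values
  \<open>m - 1 - f k\<close>.\<close>

lemma sum_inj_bounds:
  fixes f :: "nat \<Rightarrow> nat"
  assumes "finite K" "inj_on f K"
  shows "\<Sum>{..<card K} \<le> (\<Sum>k\<in>K. f k)"
    and "(\<And>k. k \<in> K \<Longrightarrow> f k < m) \<Longrightarrow> (\<Sum>k\<in>K. f k) \<le> card K * (m - card K) + \<Sum>{..<card K}"
proof -
  have lower: "\<Sum>{..<card K} \<le> (\<Sum>k\<in>K. g k)" if "inj_on g K" for g :: "nat \<Rightarrow> nat"
    using sum_lessThan_card_le[of "g ` K"] assms(1) that
    by (simp add: card_image sum.reindex)
  show "\<Sum>{..<card K} \<le> (\<Sum>k\<in>K. f k)" by (rule lower) fact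
  assume less: "\<And>k. k \<in> K \<Longrightarrow> f k < m"
  define p where "p = card K"
  have "p \<le> m"
    using card_inj_on_le[OF assms(2), of "{..<m}"] less by (auto simp: p_def)
  have "\<Sum>{..<p} \<le> (\<Sum>k\<in>K. m - 1 - f k)"
    unfolding p_def
  proof (rule lower, rule inj_onI)
    fix x y assume xy: "x \<in> K" "y \<in> K" "m - 1 - f x = m - 1 - f y"
    then have "f x = f y" using less[of x] less[of y] by linarith
    then show "x = y" using xy assms(2) by (auto dest: inj_onD)
  qed
  moreover have "(\<Sum>k\<in>K. m - 1 - f k) + (\<Sum>k\<in>K. f k) = p * (m - 1)"
  proof -
    have "(\<Sum>k\<in>K. m - 1 - f k) + (\<Sum>k\<in>K. f k) = (\<Sum>k\<in>K. m - 1)"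
      unfolding sum.distrib[symmetric] using less by (intro sum.cong) fastforce+
    then show ?thesis by (simp add: p_def)
  qed
  moreover have "2 * \<Sum>{..<p} = p * (p - 1)"
  proof (induction p)
    case (Suc n)
    then show ?case by (cases n) simp_all
  qed simp
  moreover have "p * (m - 1) = p * (m - p) + p * (p - 1)"
    using \<open>p \<le> m\<close> by (cases p) (simp_all flip: distrib_left add_mult_distrib2)
  ultimately show "(\<Sum>k\<in>K. f k) \<le> card K * (m - card K) + \<Sum>{..<card K}"
    unfolding p_def[symmetric] by linarith
qed

text \<open>This is the vanishing in the cohomology of a Grassmannian above its dimension: the
  product is antisymmetric in the roots from \<open>K\<close>, so the exponents of these roots in a surviving
  monomial are distinct, which bounds its degree.\<close>

lemma symmetric_mult_alternant:
  fixes P :: "('w + nat) zpoly"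
  assumes K: "K \<subseteq> {..<m}"
    and sym: "\<And>a b. a \<in> K \<Longrightarrow> b \<in> K \<Longrightarrow> rename (transpose a b) P = P"
    and deg: "P \<in> supp_in (\<lambda>\<kappa>. card K * (m - card K) < root_degree K \<kappa>)"
  shows "P * alternant m \<in> root_ideal m"
  unfolding root_ideal_def supp_in_def
proof (intro CollectI ballI, rule ccontr)
  fix \<kappa> assume \<kappa>: "\<kappa> \<in> Poly_Mapping.keys (P * alternant m)" and "\<not> (\<exists>k<m. m \<le> rexp \<kappa> k)"
  then have less: "rexp \<kappa> k < m" if "k \<in> K" for k using that K by (auto simp: not_le)
  have "finite K" using K finite_subset by blast
  have inj: "inj_on (rexp \<kappa>) K"
  proof (rule inj_onI, rule ccontr)
    fix a b assume ab: "a \<in> K" "b \<in> K" "rexp \<kappa> a = rexp \<kappa> b" "a \<noteq> b"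
    \<comment> \<open>Equal exponents make \<open>\<kappa>\<close> invariant under the
      transposition; by antisymmetry the coefficient there is its own negative, hence zero over the
      integers.\<close>
    have "Poly_Mapping.map_key (map_sum id (transpose a b)) \<kappa> = \<kappa>"
    proof (rule poly_mapping_eqI)
      fix v
      have "inj (map_sum id (transpose a b) :: 'w + nat \<Rightarrow> 'w + nat)" by (simp add: sum.inj_map)
      then show "Poly_Mapping.lookup (Poly_Mapping.map_key (map_sum id (transpose a b)) \<kappa>) v = Poly_Mapping.lookup \<kappa> v"
        using ab by (cases v) (auto simp: map_key.rep_eq transpose_def)
    qed
    then have "Poly_Mapping.lookup (P * alternant m) \<kappa>
        = Poly_Mapping.lookup (rename (transpose a b) (P * alternant m)) \<kappa>"
      by (simp add: lookup_rename)
    also have "rename (transpose a b) (P * alternant m) = - (P * alternant m)"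
    proof -
      have "a < m" "b < m" using ab K by auto
      then show ?thesis
        using sym[OF ab(1,2)] rename_alternant[where 'w = 'w, of a m b] ab(4) by (simp add: rename_mult)
    qed
    finally show False using \<kappa> by (simp add: in_keys_iff)
  qed
  \<comment> \<open>The alternant contributes distinct exponents on \<open>K\<close>, hence at least
    \<open>0 + ... + (card K - 1)\<close> to the degree.\<close>
  have "P * alternant m \<in> supp_in (\<lambda>\<kappa>. card K * (m - card K) + \<Sum>{..<card K} < root_degree K \<kappa>)"
  proof (rule supp_in_mult[OF deg rexp_alternant], elim exE conjE)
    fix a b :: "'w + nat \<Rightarrow>\<^sub>0 nat" and \<pi>
    assume a: "card K * (m - card K) < root_degree K a" and \<pi>: "\<pi> permutes {..<m}"
      and b: "\<forall>k. rexp b k = (if k < m then \<pi> k else 0)"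
    have "root_degree K b = (\<Sum>k\<in>K. \<pi> k)"
      unfolding root_degree_def using b K by (intro sum.cong) auto
    moreover have "inj_on \<pi> K" using permutes_inj_on[OF \<pi>] .
    ultimately have "\<Sum>{..<card K} \<le> root_degree K b"
      using sum_inj_bounds(1)[OF \<open>finite K\<close>] by simp
    then show "card K * (m - card K) + \<Sum>{..<card K} < root_degree K (a + b)"
      using a by (simp add: root_degree_add)
  qed
  from supp_inD[OF this \<kappa>] sum_inj_bounds(2)[OF \<open>finite K\<close> inj less]
  show False by (simp add: root_degree_def)
qed

text \<open>The permutations fixing \<open>m\<close> sum to \<open>rvar m ^ m * alternant m\<close>.
  Any other permutation sends some \<open>k < m\<close> to \<open>m\<close>, and its term is a
  multiple of \<open>rvar k ^ m\<close>.\<close>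

lemma alternant_Suc:
  "alternant (Suc m) - (rvar m ^ m * alternant m :: ('w + nat) zpoly) \<in> supp_in (\<lambda>\<kappa>. \<exists>k<m. m \<le> rexp \<kappa> k)"
proof -
  let ?t = "\<lambda>\<pi>. of_int (sign \<pi>) * (\<Prod>k<Suc m. rvar k ^ \<pi> k) :: ('w + nat) zpoly"
  let ?A = "{\<pi>. \<pi> permutes {..<Suc m}}" and ?B = "{\<pi>. \<pi> permutes {..<m}}"
  have BA: "?B \<subseteq> ?A" by (auto intro: permutes_subset)
  have "rvar m ^ m * alternant m = sum ?t ?B"
    unfolding alternant_def sum_distrib_left
  proof (intro sum.cong refl)
    fix \<pi> assume "\<pi> \<in> ?B"
    then have "\<pi> m = m" by (auto simp: permutes_not_in)
    then show "rvar m ^ m * (of_int (sign \<pi>) * (\<Prod>k<m. rvar k ^ \<pi> k)) = ?t \<pi>"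
      unfolding prod.lessThan_Suc by (simp only: ac_simps)
  qed
  moreover have "alternant (Suc m) = sum ?t ?A" by (simp add: alternant_def)
  ultimately have "alternant (Suc m) - rvar m ^ m * alternant m = sum ?t (?A - ?B)"
    using sum_diff[OF finite_permutations[OF finite_lessThan] BA, of ?t] by simp
  also have "\<dots> \<in> supp_in (\<lambda>\<kappa>. \<exists>k<m. m \<le> rexp \<kappa> k)"
  proof (rule supp_in_sum)
    fix \<pi> assume \<pi>: "\<pi> \<in> ?A - ?B"
    have "\<pi> m \<noteq> m"
    proof
      assume "\<pi> m = m"
      have "\<pi> permutes {..<m}"
      proof (rule permutes_superset)
        show "\<pi> permutes {..<Suc m}" using \<pi> by blast
        show "\<pi> x = x" if "x \<in> {..<Suc m} - {..<m}" for x
        proof -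
          have "x = m" using that by auto
          with \<open>\<pi> m = m\<close> show ?thesis by simp
        qed
      qed
      with \<pi> show False by blast
    qed
    have "surj \<pi>" using \<pi> permutes_surj by blast
    then obtain k where k: "\<pi> k = m" by (metis surjD)
    then have "k \<in> {..<Suc m}"
      using \<pi> permutes_in_image[of \<pi> "{..<Suc m}" k] by auto
    moreover have "k \<noteq> m" using k \<open>\<pi> m \<noteq> m\<close> by blast
    ultimately have "k < m" by simp
    show "?t \<pi> \<in> supp_in (\<lambda>\<kappa>. \<exists>k<m. m \<le> rexp \<kappa> k)"
      unfolding root_prod_monom
    proof (rule supp_in_mult_left)
      show "Poly_Mapping.single (\<Sum>k<Suc m. Poly_Mapping.single (Inr k) (\<pi> k)) 1
          \<in> supp_in (\<lambda>\<kappa>. \<exists>k<m. m \<le> rexp \<kappa> k)"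
        using k \<open>k < m\<close> by (intro supp_in_monom) (auto simp: rexp_sum lookup_add lookup_single intro!: exI[of _ k])
    qed (auto simp: lookup_add intro: trans_le_add2)
  qed
  finally show ?thesis .
qed

section \<open>Jets of a product of generic series\<close>

lemma fps_prod_nth_0: "fps_nth (\<Prod>i\<in>A. F i) 0 = (\<Prod>i\<in>A. fps_nth (F i) 0 :: 'a::comm_ring_1)"
  by (induction A rule: infinite_finite_induct) simp_all

text \<open>Modulo \<open>c\<close>, substitution and identity are ring homomorphisms that agree on
  the variables.\<close>

lemma subst_congruent:
  assumes "\<And>v. c dvd \<phi> v - zvar v"
  shows "c dvd subst \<phi> p - p"
proof (induction p rule: zpoly_induct)
  case (diff a b)
  have "subst \<phi> (a - b) - (a - b) = (subst \<phi> a - a) - (subst \<phi> b - b)"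
    by (simp add: subst_diff)
  with diff show ?case by (metis dvd_diff)
next
  case (mult a b)
  have "subst \<phi> (a * b) - a * b = subst \<phi> a * (subst \<phi> b - b) + b * (subst \<phi> a - a)"
    by (simp add: subst_mult algebra_simps)
  with mult show ?case by (metis dvd_add dvd_mult)
qed (use assms in auto)

text \<open>For finite \<open>K\<close> the coefficient of index \<open>j \<le> card K\<close> is
  the elementary symmetric polynomial of degree \<open>card K - j\<close> in the roots.\<close>

definition root_poly :: "nat set \<Rightarrow> ('w + nat) zpoly fps" where
  "root_poly K = (\<Prod>k\<in>K. fps_X + fps_const (rvar k))"

text \<open>Only coefficients of \<open>root_poly K'\<close> of index at most \<open>j\<close>
  enter, and these have degree at least \<open>card K' - j\<close>. The set \<open>K\<close>
  measuring the degree stays fixed while \<open>K'\<close> grows in the induction.\<close>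

lemma root_poly_degree:
  fixes G :: "('w + nat) zpoly fps"
  assumes "finite K" "K' \<subseteq> K"
  shows "fps_nth (root_poly K' * G) j \<in> supp_in (\<lambda>\<kappa>. card K' - j \<le> root_degree K \<kappa>)"
  using finite_subset[OF assms(2,1)] assms(2)
proof (induction K' arbitrary: j)
  case empty
  show ?case by (auto simp: supp_in_def)
next
  case (insert k L)
  have r: "(rvar k :: ('w + nat) zpoly) \<in> supp_in (\<lambda>\<kappa>. 1 \<le> root_degree K \<kappa>)"
    unfolding rvar_def zvar_def
  proof (rule supp_in_monom)
    define e where "e = (Poly_Mapping.single (Inr k) 1 :: 'w + nat \<Rightarrow>\<^sub>0 nat)"
    have "rexp e k \<le> root_degree K e"
      unfolding root_degree_def using insert.prems assms(1) by (intro member_le_sum) auto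
    then show "1 \<le> root_degree K (Poly_Mapping.single (Inr k) 1 :: 'w + nat \<Rightarrow>\<^sub>0 nat)"
      by (simp add: e_def)
  qed
  have eq: "fps_nth (root_poly (insert k L) * G) j
      = (if j = 0 then 0 else fps_nth (root_poly L * G) (j - 1)) + rvar k * fps_nth (root_poly L * G) j"
    using insert by (simp add: root_poly_def distrib_right mult.assoc)
  show ?case unfolding eq
  proof (rule supp_in_add)
    show "(if j = 0 then 0 else fps_nth (root_poly L * G) (j - 1))
        \<in> supp_in (\<lambda>\<kappa>. card (insert k L) - j \<le> root_degree K \<kappa>)"
    proof (cases "j = 0")
      case False
      have "fps_nth (root_poly L * G) (j - 1) \<in> supp_in (\<lambda>\<kappa>. card L - (j - 1) \<le> root_degree K \<kappa>)"
        using insert by simp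
      then show ?thesis using insert False by (auto elim!: supp_in_mono)
    qed simp
    have "fps_nth (root_poly L * G) j \<in> supp_in (\<lambda>\<kappa>. card L - j \<le> root_degree K \<kappa>)"
      using insert by simp
    then show "rvar k * fps_nth (root_poly L * G) j
        \<in> supp_in (\<lambda>\<kappa>. card (insert k L) - j \<le> root_degree K \<kappa>)"
      by (rule supp_in_mult[OF r]) (use insert in \<open>auto simp: root_degree_add\<close>)
  qed
qed

lemma rename_root_poly:
  assumes "\<tau> permutes K" and G: "\<And>j. rename \<tau> (fps_nth G j) = fps_nth G j"
  shows "rename \<tau> (fps_nth (root_poly K * G) j) = fps_nth (root_poly K * G) j"
proof -
  let ?r = "case_sum (\<lambda>w. zvar (Inl w)) (\<lambda>k. rvar (\<tau> k)) :: 'a + nat \<Rightarrow> ('a + nat) zpoly"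
  have "subst_fps ?r G = G" using G by (simp add: fps_eq_iff rename_def)
  moreover have "subst_fps ?r (root_poly K) = (\<Prod>k\<in>K. fps_X + fps_const (rvar (\<tau> k)))"
    by (simp add: root_poly_def subst_fps_prod subst_fps_add rename_rvar[unfolded rename_def])
  moreover have "\<dots> = root_poly K"
    using prod.permute[OF assms(1), of "\<lambda>k. fps_X + fps_const (rvar k :: ('a + nat) zpoly)"]
    by (simp only: root_poly_def o_def)
  ultimately have "subst_fps ?r (root_poly K * G) = root_poly K * G"
    by (simp add: subst_fps_mult)
  then show ?thesis unfolding rename_def by (simp only: subst_fps_nth[symmetric])
qed

section \<open>Generic series, their jets and the test by factorization\<close>

definition series :: "nat \<Rightarrow> (nat \<times> nat) zpoly fps" where
  "series i = Abs_fps (\<lambda>j. zvar (i, j))"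

definition root_series :: "nat \<Rightarrow> (nat \<times> nat + nat) zpoly fps" where
  "root_series i = Abs_fps (\<lambda>j. zvar (Inl (i, j)))"

lemma rename_root_series [simp]: "rename \<tau> (fps_nth (root_series i) j) = fps_nth (root_series i) j"
  by (simp add: root_series_def rename_def)

definition jets :: "nat \<Rightarrow> nat \<Rightarrow> (nat \<times> nat) zpoly set" where
  "jets n m = rmod.span ((\<lambda>k. fps_nth (\<Prod>i<n. series i) k) ` {..<m})"

text \<open>Substitutes \<open>X_i = (\<Prod>\<^bsub>\<sigma> k = i\<^esub> (t + rvar k)) * U_i\<close> for the generic series \<open>X_i\<close>, the
  coefficients of \<open>U_i\<close> being the left-hand variables.\<close>

definition factor :: "nat \<Rightarrow> (nat \<Rightarrow> nat) \<Rightarrow> (nat \<times> nat) zpoly \<Rightarrow> (nat \<times> nat + nat) zpoly" where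
  "factor m \<sigma> = subst (\<lambda>(i, j). fps_nth (root_poly {k. k < m \<and> \<sigma> k = i} * root_series i) j)"

lemma factor_zvar: "factor m \<sigma> (zvar (i, j)) = fps_nth (root_poly {k. k < m \<and> \<sigma> k = i} * root_series i) j"
  by (simp add: factor_def)

lemma factor_cong: "(\<And>k. k < m \<Longrightarrow> \<sigma> k = \<sigma>' k) \<Longrightarrow> factor m \<sigma> = factor m \<sigma>'"
  unfolding factor_def by (rule arg_cong[where f = subst]) (auto simp: fun_eq_iff cong: conj_cong)

lemma factor_mult: "factor m \<sigma> (p * q) = factor m \<sigma> p * factor m \<sigma> q"
  by (simp add: factor_def subst_mult)

lemma factor_prod: "factor m \<sigma> (\<Prod>i\<in>A. f i) = (\<Prod>i\<in>A. factor m \<sigma> (f i))"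
  by (simp add: factor_def subst_prod)

text \<open>Each root belongs to exactly one series, so the product of the factors is the root
  polynomial of all \<open>m\<close> roots, whatever \<open>\<sigma>\<close> is.\<close>

lemma factor_prod_series:
  assumes "\<And>k. k < m \<Longrightarrow> \<sigma> k < n"
  shows "factor m \<sigma> (fps_nth (\<Prod>i<n. series i) j)
    = fps_nth (root_poly {..<m} * (\<Prod>i<n. root_series i)) j"
proof -
  let ?f = "\<lambda>(i, j). fps_nth (root_poly {k. k < m \<and> \<sigma> k = i} * root_series i) j"
  have "subst_fps ?f (series i) = root_poly {k. k < m \<and> \<sigma> k = i} * root_series i" for i
    by (simp add: fps_eq_iff series_def)
  moreover have "(\<Prod>i<n. root_poly {k. k < m \<and> \<sigma> k = i}) = (root_poly {..<m} :: (nat \<times> nat + nat) zpoly fps)"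
    using prod.group[of "{..<m}" "{..<n}" \<sigma> "\<lambda>k. fps_X + fps_const (rvar k :: (nat \<times> nat + nat) zpoly)"] assms
    by (simp add: root_poly_def image_subset_iff)
  ultimately have "subst_fps ?f (\<Prod>i<n. series i) = root_poly {..<m} * (\<Prod>i<n. root_series i)"
    by (simp add: subst_fps_prod prod.distrib)
  then show ?thesis unfolding factor_def by (simp only: subst_fps_nth[symmetric])
qed

text \<open>Vanishing under the universal factorization of \<open>t ^ m\<close> for every
  distribution \<open>\<sigma>\<close> of the roots among the series; multiplication by the
  alternant tests for zero in the cohomology of complete flags.\<close>

definition vanishing :: "nat \<Rightarrow> nat \<Rightarrow> (nat \<times> nat) zpoly set" where
  "vanishing n m = {g. \<forall>\<sigma>. (\<forall>k<m. \<sigma> k < n) \<longrightarrow> factor m \<sigma> g * alternant m \<in> root_ideal m}"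

lemma subspace_vanishing: "rmod.subspace (vanishing n m)"
proof (rule rmod.subspaceI)
  show "0 \<in> vanishing n m" by (simp add: vanishing_def factor_def root_ideal_def)
next
  fix x y assume "x \<in> vanishing n m" "y \<in> vanishing n m"
  then show "x + y \<in> vanishing n m"
    by (simp add: vanishing_def factor_def subst_add distrib_right root_ideal_add)
next
  fix c x assume "x \<in> vanishing n m"
  then show "c * x \<in> vanishing n m"
    by (simp add: vanishing_def factor_mult mult.assoc root_ideal_mult)
qed

text \<open>For \<open>K\<close> the set of all roots the Grassmannian is a point: symmetric
  polynomials of positive degree vanish, and the coefficient of index \<open>j < m\<close> has
  degree at least \<open>m - j\<close>.\<close>

lemma jets_subset_vanishing: "jets n m \<subseteq> vanishing n m"
  unfolding jets_def
proof (rule rmod.span_minimal[OF _ subspace_vanishing], rule image_subsetI)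
  fix j assume j: "j \<in> {..<m}"
  define P where "P = (fps_nth (root_poly {..<m} * (\<Prod>i<n. root_series i)) j :: (nat \<times> nat + nat) zpoly)"
  have "P * alternant m \<in> root_ideal m"
  proof (rule symmetric_mult_alternant[OF subset_refl])
    fix a b assume ab: "a \<in> {..<m}" "b \<in> {..<m}"
    have G: "rename \<tau> (fps_nth (\<Prod>i<n. root_series i) j) = fps_nth (\<Prod>i<n. root_series i) j" for \<tau> j
    proof -
      let ?r = "case_sum (\<lambda>w. zvar (Inl w)) (\<lambda>k. rvar (\<tau> k))"
      have "subst_fps ?r (root_series i) = root_series i" for i
        by (simp add: fps_eq_iff rename_root_series[unfolded rename_def])
      then have "subst_fps ?r (\<Prod>i<n. root_series i) = (\<Prod>i<n. root_series i)"
        by (simp add: subst_fps_prod)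
      then show ?thesis unfolding rename_def by (simp only: subst_fps_nth[symmetric])
    qed
    show "rename (transpose a b) P = P"
      unfolding P_def by (rule rename_root_poly[OF permutes_swap_id[OF ab] G])
  next
    have "P \<in> supp_in (\<lambda>\<kappa>. card {..<m} - j \<le> root_degree {..<m} \<kappa>)"
      unfolding P_def by (rule root_poly_degree) auto
    then show "P \<in> supp_in (\<lambda>\<kappa>. card {..<m} * (m - card {..<m}) < root_degree {..<m} \<kappa>)"
      by (rule supp_in_mono) (use j in auto)
  qed
  then show "fps_nth (\<Prod>i<n. series i) j \<in> vanishing n m"
    by (simp add: vanishing_def factor_prod_series P_def)
qed

section \<open>Setting the last root to zero\<close>

definition kill :: "nat \<Rightarrow> ('w + nat) zpoly \<Rightarrow> ('w + nat) zpoly" where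
  "kill m = subst (case_sum (\<lambda>w. zvar (Inl w)) (\<lambda>k. if k = m then 0 else rvar k))"

lemma kill_congruent: "rvar m dvd kill m z - z"
  unfolding kill_def by (rule subst_congruent) (auto simp: rvar_def split: sum.split)

lemma kill_free: "kill m z \<in> supp_in (\<lambda>\<kappa>. rexp \<kappa> m = 0)"
proof (induction z rule: zpoly_induct)
  case one
  then show ?case by (simp add: kill_def supp_in_def)
next
  case (var v)
  show ?case
  proof (cases v)
    case (Inl w)
    then show ?thesis
      unfolding kill_def subst_zvar by (simp add: zvar_def supp_in_def lookup_single)
  next
    case (Inr k)
    then show ?thesis
      unfolding kill_def subst_zvar by (simp add: rvar_def zvar_def supp_in_def lookup_single)
  qed
next
  case (diff a b)
  then show ?case by (simp add: kill_def subst_diff supp_in_diff)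
next
  case (mult a b)
  then show ?case
    unfolding kill_def subst_mult by (rule supp_in_mult) (simp add: lookup_add)
qed

text \<open>A Gysin formula: by \<open>alternant_Suc\<close>, the product of the first \<open>m\<close> roots is the class of the
  subvariety on which the last root vanishes. The monomial \<open>\<mu>\<close> may contain further variables.\<close>

lemma kill_alternant:
  assumes z: "Poly_Mapping.single \<mu> 1 * (z * alternant (Suc m)) \<in> root_ideal (Suc m)"
    and \<mu>: "\<And>k. k < m \<Longrightarrow> rexp \<mu> k = 1" "rexp \<mu> m = 0"
  shows "kill m z * alternant m \<in> root_ideal m"
proof -
  \<comment> \<open>The ideal generated by \<open>rvar k ^ m\<close> for \<open>k < m\<close> and by
    \<open>rvar m ^ Suc m\<close>. Cancelling \<open>\<mu>\<close>, which contains each of the first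
    \<open>m\<close> roots once and not the last, leads from \<open>root_ideal (Suc m)\<close> into
    it.\<close>
  define U where "U = (\<lambda>\<kappa> :: 'a + nat \<Rightarrow>\<^sub>0 nat. (\<exists>k<m. m \<le> rexp \<kappa> k) \<or> m < rexp \<kappa> m)"
  have U: "\<And>a b. U b \<Longrightarrow> U (a + b)" by (auto simp: U_def lookup_add intro: trans_le_add2)
  have mult: "x \<in> supp_in U \<Longrightarrow> p * x \<in> supp_in U" for p x
    by (erule supp_in_mult_left) (rule U)
  have J: "x \<in> supp_in (\<lambda>\<kappa>. \<exists>k<m. m \<le> rexp \<kappa> k) \<Longrightarrow> x \<in> supp_in U" for x
    by (erule supp_in_mono) (auto simp: U_def)
  have "z * alternant (Suc m) \<in> supp_in U"
  proof (rule supp_in_mono[OF supp_in_monom_multD[OF z[unfolded root_ideal_def]]], elim exE conjE)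
    fix \<kappa> k assume k: "k < Suc m" "Suc m \<le> rexp (\<mu> + \<kappa>) k"
    show "U \<kappa>"
    proof (cases "k = m")
      case False
      with k \<mu>(1)[of k] have "k < m" "m \<le> rexp \<kappa> k" by (auto simp: lookup_add)
      then show ?thesis by (auto simp: U_def)
    qed (use k \<mu>(2) in \<open>auto simp: U_def lookup_add\<close>)
  qed
  moreover have "z * (alternant (Suc m) - rvar m ^ m * alternant m) \<in> supp_in U"
    using alternant_Suc by (intro mult J)
  moreover have "(kill m z - z) * (rvar m ^ m * alternant m) \<in> supp_in U"
  proof -
    obtain q where q: "kill m z - z = rvar m * q" using kill_congruent by (metis dvdE)
    have "rvar m ^ Suc m \<in> supp_in U"
      unfolding rvar_def zvar_power by (rule supp_in_monom) (simp add: U_def)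
    then have "(q * alternant m) * rvar m ^ Suc m \<in> supp_in U" by (rule mult)
    then show ?thesis by (simp add: q mult_ac)
  qed
  \<comment> \<open>The three terms add up to
    \<open>rvar m ^ m * (kill m z * alternant m)\<close>.\<close>
  ultimately have "z * alternant (Suc m) - z * (alternant (Suc m) - rvar m ^ m * alternant m)
      + (kill m z - z) * (rvar m ^ m * alternant m) \<in> supp_in U"
    by (intro supp_in_add supp_in_diff)
  then have "rvar m ^ m * (kill m z * alternant m) \<in> supp_in U"
    by (simp add: algebra_simps)
  then have *: "kill m z * alternant m \<in> supp_in (\<lambda>\<kappa>. U (Poly_Mapping.single (Inr m) m + \<kappa>))"
    unfolding rvar_def zvar_power by (rule supp_in_monom_multD)
  \<comment> \<open>Since the root \<open>m\<close> is absent here, the alternative of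
    \<open>U\<close> concerning its exponent cannot occur once \<open>rvar m ^ m\<close> is
    cancelled.\<close>
  have **: "kill m z * alternant m \<in> supp_in (\<lambda>\<kappa>. rexp \<kappa> m = 0)"
    by (rule supp_in_mult[OF kill_free rexp_alternant]) (auto simp: lookup_add)
  show ?thesis
    unfolding root_ideal_def supp_in_def
  proof (intro CollectI ballI)
    fix \<kappa> assume "\<kappa> \<in> Poly_Mapping.keys (kill m z * alternant m)"
    from supp_inD[OF * this] supp_inD[OF ** this] show "\<exists>k<m. m \<le> rexp \<kappa> k"
      by (auto simp: U_def lookup_add lookup_single split: if_splits)
  qed
qed

text \<open>Replaces the generic series \<open>X_i\<close> by \<open>t * X_i\<close>.\<close>

definition lower :: "nat \<Rightarrow> (nat \<times> nat) zpoly \<Rightarrow> (nat \<times> nat) zpoly" where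
  "lower i = subst (\<lambda>(i', j). if i' = i then if j = 0 then 0 else zvar (i, j - 1) else zvar (i', j))"

text \<open>Replaces \<open>X_i\<close> by \<open>X_i\<close> minus its constant coefficient,
  divided by \<open>t\<close>. This inverts \<open>lower i\<close> modulo
  \<open>zvar (i, 0)\<close>.\<close>

definition raise :: "nat \<Rightarrow> (nat \<times> nat) zpoly \<Rightarrow> (nat \<times> nat) zpoly" where
  "raise i = subst (\<lambda>(i', j). if i' = i then zvar (i, Suc j) else zvar (i', j))"

text \<open>When the last root is set to zero, its linear factor becomes \<open>t\<close> and
  multiplies the series with index \<open>\<sigma> m\<close>.\<close>

lemma kill_factor: "kill m (factor (Suc m) \<sigma> g) = factor m \<sigma> (lower (\<sigma> m) g)"
  unfolding kill_def factor_def lower_def subst_subst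
proof (rule arg_cong[where f = "\<lambda>\<phi>. subst \<phi> g"], rule ext, clarify)
  fix i j :: nat
  let ?k = "case_sum (\<lambda>w. zvar (Inl w)) (\<lambda>k. if k = m then 0 else rvar k) :: nat \<times> nat + nat \<Rightarrow> _"
  let ?K = "{k. k < m \<and> \<sigma> k = i}"
  have gs: "subst_fps ?k (root_series i) = root_series i"
    by (simp add: fps_eq_iff root_series_def)
  have rv: "subst ?k (rvar k) = (if k = m then 0 else rvar k)" for k
    by (simp add: rvar_def)
  have rp: "subst_fps ?k (root_poly ?K) = root_poly ?K"
    unfolding root_poly_def subst_fps_prod
    by (intro prod.cong refl) (auto simp: subst_fps_add rv)
  have "{k. k < Suc m \<and> \<sigma> k = i} = (if i = \<sigma> m then insert m ?K else ?K)"
    by (auto simp: less_Suc_eq)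
  then have "subst_fps ?k (root_poly {k. k < Suc m \<and> \<sigma> k = i} * root_series i)
      = (if i = \<sigma> m then fps_X * (root_poly ?K * root_series i) else root_poly ?K * root_series i)"
  proof (cases "i = \<sigma> m")
    case True
    have "root_poly (insert m ?K) = (fps_X + fps_const (rvar m)) * (root_poly ?K :: (nat \<times> nat + nat) zpoly fps)"
      by (simp add: root_poly_def)
    moreover have "{k. k < Suc m \<and> \<sigma> k = i} = insert m ?K" using True by (auto simp: less_Suc_eq)
    ultimately have "subst_fps ?k (root_poly {k. k < Suc m \<and> \<sigma> k = i} * root_series i)
        = (fps_X + fps_const (subst ?k (rvar m))) * root_poly ?K * root_series i"
      by (simp only: subst_fps_mult subst_fps_add subst_fps_X subst_fps_const gs rp)
    then show ?thesis using True by (simp only: rv if_True fps_const_0_eq_0 add_0_right mult.assoc simp_thms)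
  qed (simp add: subst_fps_mult gs rp)
  then have "subst ?k (fps_nth (root_poly {k. k < Suc m \<and> \<sigma> k = i} * root_series i) j)
      = fps_nth (if i = \<sigma> m then fps_X * (root_poly ?K * root_series i) else root_poly ?K * root_series i) j"
    by (simp only: subst_fps_nth[symmetric])
  then show "subst ?k (fps_nth (root_poly {k. k < Suc m \<and> \<sigma> k = i} * root_series i) j)
      = subst (\<lambda>(i, j). fps_nth (root_poly {k. k < m \<and> \<sigma> k = i} * root_series i) j)
          (if i = \<sigma> m then if j = 0 then 0 else zvar (\<sigma> m, j - 1) else zvar (i, j))"
    by (auto simp: mult.assoc)
qed

text \<open>The additional root is assigned to series \<open>i\<close>. The constant coefficients of
  the series before \<open>i\<close> contribute all roots assigned to these; multiplying by the rest
  of the first \<open>m\<close> roots completes the monomial needed in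
  \<open>kill_alternant\<close>.\<close>

lemma lower_vanishing:
  assumes "i < n" and g: "(\<Prod>l<i. zvar (l, 0)) * g \<in> vanishing n (Suc m)"
  shows "lower i g \<in> vanishing n m"
  unfolding vanishing_def
proof (intro CollectI allI impI)
  fix \<sigma>' :: "nat \<Rightarrow> nat" assume \<sigma>': "\<forall>k<m. \<sigma>' k < n"
  define \<sigma> where "\<sigma> = \<sigma>'(m := i)"
  define z where "z = factor (Suc m) \<sigma> g"
  define L where "L = {k. k < m \<and> \<sigma>' k < i}"
  have "factor (Suc m) \<sigma> ((\<Prod>l<i. zvar (l, 0)) * g) * alternant (Suc m) \<in> root_ideal (Suc m)"
    using g \<sigma>' assms(1) by (auto simp: vanishing_def \<sigma>_def less_Suc_eq)
  also have "factor (Suc m) \<sigma> ((\<Prod>l<i. zvar (l, 0)) * g) = (\<Prod>k\<in>L. rvar k) * (\<Prod>l<i. zvar (Inl (l, 0))) * z"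
  proof -
    have L: "L = {k \<in> {..<Suc m}. \<sigma> k < i}" by (auto simp: L_def \<sigma>_def less_Suc_eq)
    have "{k \<in> L. \<sigma> k = l} = {k. k < Suc m \<and> \<sigma> k = l}" if "l < i" for l
      using that unfolding L by auto
    moreover have "(\<Prod>k\<in>L. rvar k) = (\<Prod>l<i. \<Prod>k\<in>{k \<in> L. \<sigma> k = l}. rvar k :: (nat \<times> nat + nat) zpoly)"
      by (rule prod.group[symmetric]) (auto simp: L)
    ultimately have "(\<Prod>k\<in>L. rvar k) = (\<Prod>l<i. \<Prod>k | k < Suc m \<and> \<sigma> k = l. rvar k :: (nat \<times> nat + nat) zpoly)"
      by simp
    then show ?thesis
      by (simp add: factor_mult factor_prod factor_zvar z_def fps_prod_nth_0 root_poly_def root_series_def prod.distrib)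
  qed
  finally have J: "(\<Prod>k\<in>{..<m} - L. rvar k) * ((\<Prod>k\<in>L. rvar k) * (\<Prod>l<i. zvar (Inl (l, 0))) * z * alternant (Suc m))
      \<in> root_ideal (Suc m)"
    by (rule root_ideal_mult)
  have all: "(\<Prod>k\<in>{..<m} - L. rvar k) * (\<Prod>k\<in>L. rvar k) = (\<Prod>k<m. rvar k :: (nat \<times> nat + nat) zpoly)"
    by (rule prod.subset_diff[symmetric]) (auto simp: L_def)
  define \<mu> :: "nat \<times> nat + nat \<Rightarrow>\<^sub>0 nat"
    where "\<mu> = (\<Sum>k<m. Poly_Mapping.single (Inr k) 1) + (\<Sum>l<i. Poly_Mapping.single (Inl (l, 0)) 1)"
  have \<mu>: "(\<Prod>k<m. rvar k) * (\<Prod>l<i. zvar (Inl (l, 0))) = Poly_Mapping.single \<mu> 1"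
    by (simp only: rvar_def zvar_def prod_monom mult_single \<mu>_def mult_1)
  have "Poly_Mapping.single \<mu> 1 * (z * alternant (Suc m)) \<in> root_ideal (Suc m)"
    using J by (simp only: \<mu>[symmetric] all[symmetric] mult.assoc)
  then have "kill m z * alternant m \<in> root_ideal m"
    by (rule kill_alternant) (auto simp: \<mu>_def lookup_add lookup_sum lookup_single when_def)
  moreover have "kill m z = factor m \<sigma> (lower i g)"
    using kill_factor[of m \<sigma> g] by (simp add: z_def \<sigma>_def)
  moreover have "factor m \<sigma> = factor m \<sigma>'" by (rule factor_cong) (simp add: \<sigma>_def)
  ultimately show "factor m \<sigma>' (lower i g) * alternant m \<in> root_ideal m" by simp
qed

lemma raise_lower_congruent: "zvar (i, 0) dvd raise i (lower i g) - g"
  unfolding raise_def lower_def subst_subst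
  by (rule subst_congruent) (auto split: if_splits)

text \<open>Modulo \<open>zvar (i, 0)\<close>, raising divides the product of the series by
  \<open>t\<close> and so shifts the indices of its coefficients by one.\<close>

lemma raise_series_prod:
  assumes "i < n"
  shows "zvar (i, 0) dvd raise i (fps_nth (\<Prod>l<n. series l) j) - fps_nth (\<Prod>l<n. series l) (Suc j)"
proof -
  let ?r = "\<lambda>(i', j). if i' = i then zvar (i, Suc j) else zvar (i', j)"
  define G where "G = (\<Prod>l\<in>{..<n} - {i}. series l)"
  have split: "(\<Prod>l<n. series l) = series i * G"
    unfolding G_def using assms by (intro prod.remove) auto
  have ri: "fps_X * subst_fps ?r (series i) = series i - fps_const (zvar (i, 0))"
    by (auto simp: fps_eq_iff series_def)
  have "subst_fps ?r (series l) = series l" if "l \<noteq> i" for l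
    using that by (simp add: fps_eq_iff series_def)
  then have "subst_fps ?r G = G" by (simp add: G_def subst_fps_prod)
  then have "fps_X * subst_fps ?r (\<Prod>l<n. series l) = (fps_X * subst_fps ?r (series i)) * G"
    by (simp only: split subst_fps_mult mult.assoc)
  also have "\<dots> = (\<Prod>l<n. series l) - fps_const (zvar (i, 0)) * G"
    by (simp add: ri split algebra_simps)
  finally have "fps_nth (fps_X * subst_fps ?r (\<Prod>l<n. series l)) (Suc j)
      = fps_nth ((\<Prod>l<n. series l) - fps_const (zvar (i, 0)) * G) (Suc j)" by simp
  then have "raise i (fps_nth (\<Prod>l<n. series l) j) - fps_nth (\<Prod>l<n. series l) (Suc j)
      = - (zvar (i, 0) * fps_nth G (Suc j))"
    by (simp add: raise_def)
  then show ?thesis by simp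
qed

lemma raise_jets:
  assumes "i < n" "s \<in> jets n m"
  shows "\<exists>s'\<in>jets n (Suc m). zvar (i, 0) dvd raise i s - s'"
  using assms(2) unfolding jets_def
proof (induction rule: rmod.span_induct_alt)
  case base
  show ?case by (rule bexI[of _ 0]) (auto simp: raise_def rmod.span_zero)
next
  case (step c x y)
  then obtain k s' where k: "k < m" "x = fps_nth (\<Prod>l<n. series l) k"
    and s': "s' \<in> rmod.span ((\<lambda>k. fps_nth (\<Prod>i<n. series i) k) ` {..<Suc m})" "zvar (i, 0) dvd raise i y - s'"
    by blast
  let ?f = "fps_nth (\<Prod>l<n. series l) (Suc k)"
  have "raise i (c * x + y) - (raise i c * ?f + s') = raise i c * (raise i x - ?f) + (raise i y - s')"
    by (simp add: raise_def subst_add subst_mult algebra_simps)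
  also have "zvar (i, 0) dvd \<dots>"
    unfolding k(2) using raise_series_prod[OF assms(1)] s'(2) by (intro dvd_add dvd_mult)
  finally show ?case
    using s'(1) k(1)
    by (intro bexI[of _ "raise i c * ?f + s'"] rmod.span_add[OF rmod.span_scale[OF rmod.span_base] s'(1)]) auto
qed

text \<open>With \<open>x\<^sub>0, y\<^sub>0, \<dots>\<close> the constant coefficients of the series, the ring is filtered by the ideals
  generated by the jets together with \<open>1\<close>, \<open>x\<^sub>0\<close>, \<open>x\<^sub>0 y\<^sub>0\<close> and so on, the last of these products
  being itself a jet. On each quotient of the filtration one series is divisible by \<open>t\<close>, and dividing
  by it lowers \<open>m\<close>.\<close>

theorem vanishing_subset_jets: "g \<in> vanishing n m \<Longrightarrow> g \<in> jets n m"
proof (induction m arbitrary: g)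
  case 0
  \<comment> \<open>Without roots, \<open>factor\<close> only moves the variables to the left
    summand, the alternant is \<open>1\<close> and \<open>root_ideal 0\<close> is zero.\<close>
  have "factor 0 (\<lambda>_. 0) g * alternant 0 \<in> root_ideal 0" using 0 by (simp add: vanishing_def)
  then have "factor 0 (\<lambda>_. 0) g = 0"
    by (simp add: root_ideal_def supp_in_def alternant_def)
  moreover have "subst (case_sum zvar (\<lambda>_. 0)) (factor 0 (\<lambda>_. 0) g) = subst zvar g"
    unfolding factor_def subst_subst
    by (rule arg_cong[where f = "\<lambda>\<phi>. subst \<phi> g"]) (auto simp: root_poly_def root_series_def)
  ultimately have "g = 0" by (simp add: subst_id)
  then show ?case by (simp add: jets_def rmod.span_zero)
next
  case (Suc m)
  have "\<exists>s\<in>jets n (Suc m). \<exists>g'. g = s + (\<Prod>l<i. zvar (l, 0)) * g'" if "i \<le> n" for i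
    using that
  proof (induction i)
    case 0
    show ?case by (rule bexI[of _ 0]) (auto simp: jets_def rmod.span_zero)
  next
    case (Suc i)
    then obtain s g' where s: "s \<in> jets n (Suc m)" and g: "g = s + (\<Prod>l<i. zvar (l, 0)) * g'" by auto
    have "g - s \<in> vanishing n (Suc m)"
      using Suc.prems \<open>g \<in> vanishing n (Suc m)\<close> s jets_subset_vanishing
      by (blast intro: rmod.subspace_diff[OF subspace_vanishing])
    then have "lower i g' \<in> vanishing n m"
      using lower_vanishing[of i n g' m] Suc.prems g by simp
    then obtain s' where s': "s' \<in> jets n (Suc m)" "zvar (i, 0) dvd raise i (lower i g') - s'"
      using raise_jets[of i n] Suc.prems \<open>\<And>g. g \<in> vanishing n m \<Longrightarrow> g \<in> jets n m\<close> by fastforce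
    \<comment> \<open>Modulo \<open>zvar (i, 0)\<close>, both \<open>g'\<close> and the jet
      \<open>s'\<close> agree with \<open>raise i (lower i g')\<close>.\<close>
    have "zvar (i, 0) dvd (raise i (lower i g') - s') - (raise i (lower i g') - g')"
      using s'(2) raise_lower_congruent by (rule dvd_diff)
    then obtain q where "g' - s' = zvar (i, 0) * q" by (auto elim: dvdE)
    then have g': "g' = s' + zvar (i, 0) * q" by (simp add: algebra_simps)
    have "g = (s + (\<Prod>l<i. zvar (l, 0)) * s') + (\<Prod>l<Suc i. zvar (l, 0)) * q"
      by (simp only: g g' prod.lessThan_Suc distrib_left add.assoc mult.assoc)
    moreover have "s + (\<Prod>l<i. zvar (l, 0)) * s' \<in> jets n (Suc m)"
      using s s'(1) unfolding jets_def by (intro rmod.span_add rmod.span_scale)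
    ultimately show ?case by blast
  qed
  from this[of n] obtain s g' where s: "s \<in> jets n (Suc m)" and g: "g = s + (\<Prod>l<n. zvar (l, 0)) * g'"
    by blast
  have "(\<Prod>l<n. zvar (l, 0)) = fps_nth (\<Prod>i<n. series i) 0"
    by (simp add: fps_prod_nth_0 series_def)
  then have "(\<Prod>l<n. zvar (l, 0)) \<in> jets n (Suc m)"
    unfolding jets_def by (intro rmod.span_base) auto
  then have "g' * (\<Prod>l<n. zvar (l, 0)) \<in> jets n (Suc m)"
    unfolding jets_def by (rule rmod.span_scale)
  then show ?case using s unfolding g jets_def by (simp add: rmod.span_add mult.commute)
qed

section \<open>Powers of the chosen coefficients lie in the ideal of jets\<close>

lemma supp_in_root_degree_power:
  assumes "p \<in> supp_in (\<lambda>\<kappa>. e \<le> root_degree K \<kappa>)"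
  shows "p ^ d \<in> supp_in (\<lambda>\<kappa>. d * e \<le> root_degree K \<kappa>)"
proof (induction d)
  case (Suc d)
  show ?case unfolding power_Suc
    by (rule supp_in_mult[OF assms Suc]) (simp add: root_degree_add)
qed (simp add: supp_in_def)

theorem prod_power_in_jets:
  assumes d: "\<And>i. i < n \<Longrightarrow> (h i + 1) * ((\<Sum>l<n. h l) - h i) < d"
  shows "(\<Prod>i<n. zvar (i, h i) ^ d) \<in> jets n (Suc (\<Sum>l<n. h l))"
proof (rule vanishing_subset_jets, unfold vanishing_def, intro CollectI allI impI)
  define H where "H = (\<Sum>l<n. h l)"
  fix \<sigma> :: "nat \<Rightarrow> nat" assume \<sigma>: "\<forall>k<Suc (\<Sum>l<n. h l). \<sigma> k < n"
  define K where "K i = {k. k < Suc H \<and> \<sigma> k = i}" for i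
  \<comment> \<open>Pigeonhole: \<open>H + 1\<close> roots are distributed, while the numbers
    \<open>h i\<close> sum to \<open>H\<close>.\<close>
  have "(\<Sum>i<n. card (K i)) = Suc H"
    using sum.group[of "{..<Suc H}" "{..<n}" \<sigma> "\<lambda>_. 1::nat"] \<sigma> by (auto simp: K_def H_def image_subset_iff)
  then have "\<not> (\<forall>i<n. card (K i) \<le> h i)"
    using sum_mono[of "{..<n}" "\<lambda>i. card (K i)" h] by (auto simp: H_def)
  then obtain i where i: "i < n" "h i < card (K i)" by auto
  define P where "P = factor (Suc H) \<sigma> (zvar (i, h i))"
  have P: "P = fps_nth (root_poly (K i) * root_series i) (h i)"
    by (simp add: P_def factor_zvar K_def)
  have "P ^ d * alternant (Suc H) \<in> root_ideal (Suc H)"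
  proof (rule symmetric_mult_alternant)
    show "K i \<subseteq> {..<Suc H}" by (auto simp: K_def)
    show "rename (transpose a b) (P ^ d) = P ^ d" if "a \<in> K i" "b \<in> K i" for a b
      using rename_root_poly[OF permutes_swap_id[OF that], of "root_series i"]
      by (simp add: rename_power P)
    have "P \<in> supp_in (\<lambda>\<kappa>. card (K i) - h i \<le> root_degree (K i) \<kappa>)"
      unfolding P by (rule root_poly_degree) (auto simp: K_def)
    then have "P ^ d \<in> supp_in (\<lambda>\<kappa>. d * (card (K i) - h i) \<le> root_degree (K i) \<kappa>)"
      by (rule supp_in_root_degree_power)
    \<comment> \<open>With \<open>q = card (K i) - h i \<ge> 1\<close>, the first factor is at most
      \<open>(h i + 1) * q\<close> and the second at most \<open>H - h i\<close>. Both bounds are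
      sharp for \<open>q = 1\<close>, which explains the bound on \<open>d\<close>.\<close>
    moreover have "card (K i) * (Suc H - card (K i)) < d * (card (K i) - h i)"
    proof -
      obtain s where s: "card (K i) = h i + Suc s" using i(2) less_imp_Suc_add by fastforce
      have "h i + Suc s \<le> (h i + 1) * Suc s" by simp
      moreover have "Suc H - card (K i) \<le> H - h i" using s by simp
      ultimately have "card (K i) * (Suc H - card (K i)) \<le> (h i + 1) * Suc s * (H - h i)"
        unfolding s by (intro mult_mono) auto
      also have "\<dots> = (h i + 1) * (H - h i) * Suc s" by (simp only: mult_ac)
      also have "\<dots> < d * Suc s" using d[OF i(1)] by (intro mult_strict_right_mono) (auto simp: H_def)
      finally show ?thesis using s by simp
    qed
    ultimately show "P ^ d \<in> supp_in (\<lambda>\<kappa>. card (K i) * (Suc H - card (K i)) < root_degree (K i) \<kappa>)"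
      by (auto elim: supp_in_mono)
  qed
  moreover have "factor (Suc H) \<sigma> (\<Prod>l<n. zvar (l, h l) ^ d)
      = (\<Prod>l\<in>{..<n} - {i}. factor (Suc H) \<sigma> (zvar (l, h l) ^ d)) * P ^ d"
  proof -
    have "(\<Prod>l<n. zvar (l, h l) ^ d) = zvar (i, h i) ^ d * (\<Prod>l\<in>{..<n} - {i}. zvar (l, h l) ^ d)"
      using i(1) by (intro prod.remove) auto
    moreover have "factor (Suc H) \<sigma> (zvar (i, h i) ^ d) = P ^ d"
      by (simp add: P_def factor_def subst_power)
    ultimately show ?thesis by (simp only: factor_mult factor_prod mult.commute)
  qed
  ultimately show "factor (Suc (\<Sum>l<n. h l)) \<sigma> (\<Prod>i<n. zvar (i, h i) ^ d) * alternant (Suc (\<Sum>l<n. h l))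
      \<in> root_ideal (Suc (\<Sum>l<n. h l))"
    by (simp add: H_def mult.assoc root_ideal_mult)
qed

section \<open>Polarization\<close>

text \<open>The alternating sum is the iterated difference of the \<open>k\<close>-th power at
  \<open>0\<close> in the directions \<open>a i\<close>; each difference lowers the degree. Removing
  one direction expands into powers below \<open>k\<close>, of which only that of exponent
  \<open>card I\<close> survives.\<close>

lemma polarization:
  fixes a :: "'i \<Rightarrow> 'r::comm_ring_1"
  assumes "finite I" "k \<le> card I"
  shows "(\<Sum>S\<in>Pow I. (-1) ^ card (I - S) * (\<Sum>i\<in>S. a i) ^ k)
    = (if k = card I then of_nat (fact k) * (\<Prod>i\<in>I. a i) else 0)"
  using assms
proof (induction I arbitrary: k rule: finite_induct)
  case empty
  then show ?case by simp
next
  case (insert b I)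
  define E where "E l = (\<Sum>S\<in>Pow I. (-1) ^ card (I - S) * (\<Sum>i\<in>S. a i) ^ l)" for l
  have c1: "card (insert b I - S) = Suc (card (I - S))" if "S \<subseteq> I" for S
  proof -
    have "insert b I - S = insert b (I - S)" using that insert by auto
    then show ?thesis using insert by simp
  qed
  have c2: "insert b I - insert b S = I - S" for S using insert by auto
  have inj: "inj_on (insert b) (Pow I)"
    using insert.hyps(2) by (intro inj_onI) (metis PowD insert_ident subset_iff)
  have "(\<Sum>S\<in>Pow (insert b I). (-1) ^ card (insert b I - S) * (\<Sum>i\<in>S. a i) ^ k)
      = (\<Sum>S\<in>Pow I. (-1) ^ card (insert b I - S) * (\<Sum>i\<in>S. a i) ^ k)
        + (\<Sum>S\<in>insert b ` Pow I. (-1) ^ card (insert b I - S) * (\<Sum>i\<in>S. a i) ^ k)"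
    unfolding Pow_insert using insert by (intro sum.union_disjoint) auto
  also have "(\<Sum>S\<in>insert b ` Pow I. (-1) ^ card (insert b I - S) * (\<Sum>i\<in>S. a i) ^ k)
      = (\<Sum>S\<in>Pow I. (-1) ^ card (insert b I - insert b S) * (\<Sum>i\<in>insert b S. a i) ^ k)"
    by (rule sum.reindex_cong[OF inj refl refl])
  also have "\<dots> = (\<Sum>S\<in>Pow I. (-1) ^ card (I - S) * ((\<Sum>i\<in>S. a i) + a b) ^ k)"
  proof (intro sum.cong refl)
    fix S assume "S \<in> Pow I"
    then have "finite S" "b \<notin> S" using insert finite_subset by auto
    then show "(-1) ^ card (insert b I - insert b S) * (\<Sum>i\<in>insert b S. a i) ^ k
        = (-1) ^ card (I - S) * ((\<Sum>i\<in>S. a i) + a b) ^ k"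
      by (simp add: c2 add.commute)
  qed
  also have "(\<Sum>S\<in>Pow I. (-1) ^ card (insert b I - S) * (\<Sum>i\<in>S. a i) ^ k)
      + (\<Sum>S\<in>Pow I. (-1) ^ card (I - S) * ((\<Sum>i\<in>S. a i) + a b) ^ k)
      = (\<Sum>S\<in>Pow I. (-1) ^ card (I - S) * (((\<Sum>i\<in>S. a i) + a b) ^ k - (\<Sum>i\<in>S. a i) ^ k))"
    unfolding sum.distrib[symmetric] by (intro sum.cong refl) (simp add: c1 algebra_simps)
  also have "\<dots> = (\<Sum>S\<in>Pow I. \<Sum>l<k. of_nat (k choose l) * a b ^ (k - l)
      * ((-1) ^ card (I - S) * (\<Sum>i\<in>S. a i) ^ l))"
  proof (intro sum.cong refl)
    fix S
    have "((\<Sum>i\<in>S. a i) + a b) ^ k - (\<Sum>i\<in>S. a i) ^ k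
        = (\<Sum>l<k. of_nat (k choose l) * (\<Sum>i\<in>S. a i) ^ l * a b ^ (k - l))"
      unfolding binomial_ring lessThan_Suc_atMost[symmetric] by simp
    then show "(-1) ^ card (I - S) * (((\<Sum>i\<in>S. a i) + a b) ^ k - (\<Sum>i\<in>S. a i) ^ k)
        = (\<Sum>l<k. of_nat (k choose l) * a b ^ (k - l) * ((-1) ^ card (I - S) * (\<Sum>i\<in>S. a i) ^ l))"
      by (simp add: sum_distrib_left mult_ac)
  qed
  also have "\<dots> = (\<Sum>l<k. of_nat (k choose l) * a b ^ (k - l) * E l)"
    unfolding E_def by (subst sum.swap) (simp add: sum_distrib_left)
  also have "\<dots> = (\<Sum>l<k. if l = card I then of_nat (k choose l) * a b ^ (k - l) * (of_nat (fact l) * (\<Prod>i\<in>I. a i)) else 0)"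
  proof (intro sum.cong refl)
    fix l assume "l \<in> {..<k}"
    then have "l \<le> card I" using insert by simp
    from insert.IH[OF this] show "of_nat (k choose l) * a b ^ (k - l) * E l
        = (if l = card I then of_nat (k choose l) * a b ^ (k - l) * (of_nat (fact l) * (\<Prod>i\<in>I. a i)) else 0)"
      by (simp add: E_def)
  qed
  also have "\<dots> = (if k = card (insert b I) then of_nat (fact k) * (\<Prod>i\<in>insert b I. a i) else 0)"
  proof (cases "k = Suc (card I)")
    case True
    then show ?thesis using insert by (simp add: algebra_simps)
  qed (use insert in auto)
  finally show ?case .
qed

text \<open>Now there are \<open>n * d\<close> generic series in \<open>n\<close> blocks of length
  \<open>d\<close>, and \<open>\<alpha>\<close> picks one from each block.\<close>

definition polar_jets :: "nat \<Rightarrow> nat \<Rightarrow> nat \<Rightarrow> (nat \<times> nat) zpoly set" where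
  "polar_jets n d m = rmod.span {fps_nth (\<Prod>i<n. series (\<alpha> i)) j | \<alpha> j.
     j < m \<and> (\<forall>i<n. \<alpha> i \<in> {i * d..<i * d + d})}"

text \<open>The substituted series is \<open>\<Sum>\<^bsub>t \<in> B i\<^esub> X ^ (h i - k t) * Y_t\<close>: the shifts move the coefficient of
  index \<open>k t\<close> of each \<open>Y_t\<close> to the common index \<open>h i\<close>.\<close>

lemma prod_sum_power_in_polar_jets:
  assumes B: "\<And>i. i < n \<Longrightarrow> B i \<subseteq> {i * d..<i * d + d}"
    and k: "\<And>i t. i < n \<Longrightarrow> t \<in> B i \<Longrightarrow> k t \<le> h i"
    and d: "\<And>i. i < n \<Longrightarrow> (h i + 1) * ((\<Sum>l<n. h l) - h i) < d"
  shows "(\<Prod>i<n. (\<Sum>t\<in>B i. zvar (t, k t)) ^ d) \<in> polar_jets n d (Suc (\<Sum>i<n. h i))"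
proof -
  define m where "m = Suc (\<Sum>i<n. h i)"
  define F where "F i = (\<Sum>t\<in>B i. fps_X ^ (h i - k t) * series t)" for i
  define \<theta> where "\<theta> = (\<lambda>(i, l). fps_nth (F i) l)"
  have series: "subst_fps \<theta> (series i) = F i" for i
    by (simp add: fps_eq_iff series_def \<theta>_def)
  have finB: "finite (B i)" if "i < n" for i using B[OF that] finite_subset by blast
  have gen: "subst \<theta> (fps_nth (\<Prod>i<n. series i) j) \<in> polar_jets n d m" if "j < m" for j
  proof -
    have "subst_fps \<theta> (\<Prod>i<n. series i) = (\<Prod>i<n. F i)"
      by (simp add: subst_fps_prod series)
    \<comment> \<open>Each choice \<open>\<alpha>\<close> yields a power of \<open>t\<close> times a
      product of one series per block, whose coefficient is zero or one of no larger index.\<close>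
    also have "\<dots> = (\<Sum>\<alpha>\<in>Pi\<^sub>E {..<n} B. \<Prod>i<n. fps_X ^ (h i - k (\<alpha> i)) * series (\<alpha> i))"
      unfolding F_def using finB by (intro prod_sum_PiE) auto
    also have "\<dots> = (\<Sum>\<alpha>\<in>Pi\<^sub>E {..<n} B. fps_X ^ (\<Sum>i<n. h i - k (\<alpha> i)) * (\<Prod>i<n. series (\<alpha> i)))"
      by (simp add: prod.distrib power_sum)
    finally have "subst \<theta> (fps_nth (\<Prod>i<n. series i) j)
        = (\<Sum>\<alpha>\<in>Pi\<^sub>E {..<n} B. fps_nth (fps_X ^ (\<Sum>i<n. h i - k (\<alpha> i)) * (\<Prod>i<n. series (\<alpha> i))) j)"
      by (simp only: subst_fps_nth[symmetric] fps_sum_nth)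
    also have "\<dots> \<in> polar_jets n d m"
      unfolding polar_jets_def
    proof (rule rmod.span_sum)
      fix \<alpha> assume "\<alpha> \<in> Pi\<^sub>E {..<n} B"
      then have "\<forall>i<n. \<alpha> i \<in> {i * d..<i * d + d}" using B by blast
      then show "fps_nth (fps_X ^ (\<Sum>i<n. h i - k (\<alpha> i)) * (\<Prod>i<n. series (\<alpha> i))) j
          \<in> rmod.span {fps_nth (\<Prod>i<n. series (\<alpha> i)) j | \<alpha> j. j < m \<and> (\<forall>i<n. \<alpha> i \<in> {i * d..<i * d + d})}"
        using \<open>j < m\<close> by (auto simp: fps_X_power_mult_nth rmod.span_zero intro!: rmod.span_base exI[of _ \<alpha>])
    qed
    finally show ?thesis .
  qed
  have "subst \<theta> s \<in> polar_jets n d m" if "s \<in> jets n m" for s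
    using that unfolding jets_def
  proof (induction rule: rmod.span_induct_alt)
    case base
    then show ?case by (simp add: polar_jets_def rmod.span_zero)
  next
    case (step c x y)
    then have "subst \<theta> x \<in> polar_jets n d m" using gen by auto
    with step show ?case
      by (simp add: polar_jets_def subst_add subst_mult rmod.span_add rmod.span_scale)
  qed
  then have "subst \<theta> (\<Prod>i<n. zvar (i, h i) ^ d) \<in> polar_jets n d m"
    using prod_power_in_jets[OF d] by (simp add: m_def)
  also have "subst \<theta> (\<Prod>i<n. zvar (i, h i) ^ d) = (\<Prod>i<n. (\<Sum>t\<in>B i. zvar (t, k t)) ^ d)"
    unfolding subst_prod subst_power
  proof (intro prod.cong refl arg_cong[where f = "\<lambda>x. x ^ d"])
    fix i assume "i \<in> {..<n}"
    then have "subst \<theta> (zvar (i, h i)) = (\<Sum>t\<in>B i. fps_nth (fps_X ^ (h i - k t) * series t) (h i))"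
      by (simp add: \<theta>_def F_def fps_sum_nth)
    also have "\<dots> = (\<Sum>t\<in>B i. zvar (t, k t))"
      using \<open>i \<in> {..<n}\<close> k by (intro sum.cong refl) (auto simp: fps_X_power_mult_nth series_def)
    finally show "subst \<theta> (zvar (i, h i)) = (\<Sum>t\<in>B i. zvar (t, k t))" .
  qed
  finally show ?thesis by (simp add: m_def)
qed

text \<open>Polarizing each block separately produces \<open>d\<close>-th powers of subset sums;
  expanding over all choices of subsets reduces to
  \<open>prod_sum_power_in_polar_jets\<close>.\<close>

theorem prod_in_polar_jets:
  assumes k: "\<And>i t. i < n \<Longrightarrow> t \<in> {i * d..<i * d + d} \<Longrightarrow> k t \<le> h i"
    and d: "\<And>i. i < n \<Longrightarrow> (h i + 1) * ((\<Sum>l<n. h l) - h i) < d"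
  shows "of_nat (fact d ^ n) * (\<Prod>t<n * d. zvar (t, k t)) \<in> polar_jets n d (Suc (\<Sum>i<n. h i))"
proof -
  define G where "G i = {i * d..<i * d + d}" for i
  define y where "y t = (zvar (t, k t) :: (nat \<times> nat) zpoly)" for t
  have "of_nat (fact d ^ n) * (\<Prod>t<n * d. y t) = (\<Prod>i<n. of_nat (fact d) * (\<Prod>t\<in>G i. y t))"
    unfolding prod.nat_group[of y d n, symmetric] by (simp add: prod.distrib G_def)
  also have "\<dots> = (\<Prod>i<n. \<Sum>S\<in>Pow (G i). (-1) ^ card (G i - S) * (\<Sum>t\<in>S. y t) ^ d)"
    by (intro prod.cong refl, subst polarization) (auto simp: G_def)
  also have "\<dots> = (\<Sum>B\<in>Pi\<^sub>E {..<n} (\<lambda>i. Pow (G i)). \<Prod>i<n. (-1) ^ card (G i - B i) * (\<Sum>t\<in>B i. y t) ^ d)"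
    by (intro prod_sum_PiE) (auto simp: G_def)
  also have "\<dots> = (\<Sum>B\<in>Pi\<^sub>E {..<n} (\<lambda>i. Pow (G i)). (\<Prod>i<n. (-1) ^ card (G i - B i)) * (\<Prod>i<n. (\<Sum>t\<in>B i. y t) ^ d))"
    by (simp add: prod.distrib)
  also have "\<dots> \<in> polar_jets n d (Suc (\<Sum>i<n. h i))"
    unfolding polar_jets_def
  proof (intro rmod.span_sum rmod.span_scale)
    fix B assume "B \<in> Pi\<^sub>E {..<n} (\<lambda>i. Pow (G i))"
    then have B: "B i \<subseteq> {i * d..<i * d + d}" if "i < n" for i using that by (auto simp: G_def PiE_def)
    then have "(\<Prod>i<n. (\<Sum>t\<in>B i. y t) ^ d) \<in> polar_jets n d (Suc (\<Sum>i<n. h i))"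
      unfolding y_def using k by (intro prod_sum_power_in_polar_jets d) blast+
    then show "(\<Prod>i<n. (\<Sum>t\<in>B i. y t) ^ d) \<in> rmod.span {fps_nth (\<Prod>i<n. series (\<alpha> i)) j | \<alpha> j.
        j < Suc (\<Sum>i<n. h i) \<and> (\<forall>i<n. \<alpha> i \<in> {i * d..<i * d + d})}"
      by (simp only: polar_jets_def)
  qed
  finally show ?thesis by (simp only: y_def)
qed

section \<open>Powers of ideals and divided derivatives\<close>

lemma (in cring) poly_eval_span:
  assumes \<phi>: "\<And>v. \<phi> v \<in> carrier R" and T: "ideal T R"
    and gen: "\<And>g. g \<in> G \<Longrightarrow> poly_eval \<phi> g \<in> T" and p: "p \<in> rmod.span G"
  shows "poly_eval \<phi> p \<in> T"
  using p
proof (induction rule: rmod.span_induct_alt)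
  case base
  show ?case using additive_subgroup.zero_closed[OF ideal.axioms(1)[OF T]] \<phi> by simp
next
  case (step c x y)
  then show ?case
    using \<phi> gen[of x] T by (simp add: poly_eval_add poly_eval_mult ideal.I_l_closed
        additive_subgroup.a_closed[OF ideal.axioms(1)[OF T]])
qed

text \<open>Each factor of the power may use generators of a different ideal containing
  \<open>J\<close>. With a generator \<open>g\<close> as last factor, induction applies to the colon
  ideal of \<open>T\<close> by \<open>g\<close>; the colon ideal by \<open>x\<close> then replaces
  \<open>g\<close> by any element of \<open>J\<close>.\<close>

lemma (in cring) pow_ideal_subset:
  fixes N :: nat
  assumes J: "J \<subseteq> carrier R" and T: "ideal T R"
    and G: "\<forall>t<N. G t \<subseteq> carrier R" "\<forall>t<N. J \<subseteq> genideal R (G t)"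
    and prods: "\<forall>g. (\<forall>t<N. g t \<in> G t) \<longrightarrow> (\<Otimes>t\<in>{..<N}. g t) \<in> T"
  shows "J [^]\<^bsub>ideals_set R\<^esub> N \<subseteq> T"
  using assms
proof (induction N arbitrary: T)
  case 0
  have "\<one> \<in> T" using 0(5) by simp
  then show ?case
    using ideal.one_imp_carrier[OF 0(2)] unfolding ideals_set_pow by simp
next
  case (Suc N)
  interpret T: ideal T R by fact
  have colon: "ideal {x \<in> carrier R. x \<otimes> a \<in> T} R" if a: "a \<in> carrier R" for a
  proof (rule idealI[OF ring_axioms])
    show "subgroup {x \<in> carrier R. x \<otimes> a \<in> T} (add_monoid R)"
      using a by (intro add.subgroupI) (auto simp: l_distr l_minus intro!: exI[of _ \<zero>])
  next
    fix b x assume "b \<in> {x \<in> carrier R. x \<otimes> a \<in> T}" and x: "x \<in> carrier R"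
    then have b: "b \<in> carrier R" "x \<otimes> (b \<otimes> a) \<in> T" by (auto intro: T.I_l_closed)
    then show "x \<otimes> b \<in> {x \<in> carrier R. x \<otimes> a \<in> T}" using a x by (simp add: m_assoc)
    then show "b \<otimes> x \<in> {x \<in> carrier R. x \<otimes> a \<in> T}" using b(1) x by (simp add: m_comm)
  qed
  have Gc: "\<And>t. t < N \<Longrightarrow> G t \<subseteq> carrier R" "G N \<subseteq> carrier R" using Suc.prems(3) by simp_all
  have step: "x \<otimes> a \<in> T" if x: "x \<in> J [^]\<^bsub>ideals_set R\<^esub> N" and a: "a \<in> J" for x a
  proof -
    have xg: "x \<in> carrier R \<and> x \<otimes> g \<in> T" if g: "g \<in> G N" for g
    proof -
      have gc: "g \<in> carrier R" using g Gc(2) by blast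
      have "J [^]\<^bsub>ideals_set R\<^esub> N \<subseteq> {x \<in> carrier R. x \<otimes> g \<in> T}"
      proof (rule Suc.IH[OF Suc.prems(1) colon[OF gc]], goal_cases)
        case 3
        show ?case
        proof (intro allI impI)
          fix f assume f: "\<forall>t<N. f t \<in> G t"
          have fc: "f \<in> {..<N} \<rightarrow> carrier R" using f Gc by blast
          have "(\<Otimes>t\<in>{..<Suc N}. (f(N := g)) t) \<in> T"
            by (rule Suc.prems(5)[rule_format]) (use f g in \<open>auto simp: less_Suc_eq\<close>)
          also have "(\<Otimes>t\<in>{..<Suc N}. (f(N := g)) t) = g \<otimes> (\<Otimes>t\<in>{..<N}. (f(N := g)) t)"
            unfolding lessThan_Suc using fc gc by (subst finprod_insert) auto
          also have "(\<Otimes>t\<in>{..<N}. (f(N := g)) t) = (\<Otimes>t\<in>{..<N}. f t)"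
            using fc by (intro finprod_cong') auto
          finally show "(\<Otimes>t\<in>{..<N}. f t) \<in> {x \<in> carrier R. x \<otimes> g \<in> T}"
            using fc gc by (auto simp: m_comm)
        qed
      qed (use Suc.prems(3,4) in simp_all)
      with x show ?thesis by blast
    qed
    \<comment> \<open>The whole ring as target merely places the power inside the carrier.\<close>
    have "J [^]\<^bsub>ideals_set R\<^esub> N \<subseteq> carrier R"
    proof (rule Suc.IH[OF Suc.prems(1) oneideal])
      show "\<forall>g. (\<forall>t<N. g t \<in> G t) \<longrightarrow> (\<Otimes>t\<in>{..<N}. g t) \<in> carrier R"
        using Gc(1) by (intro allI impI finprod_closed) blast
    qed (use Suc.prems(3,4) in simp_all)
    with x have "x \<in> carrier R" by blast
    have "g \<otimes> x \<in> T" if "g \<in> G N" for g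
      using xg[OF that] Gc(2) that by (metis m_comm subsetD)
    then have "G N \<subseteq> {y \<in> carrier R. y \<otimes> x \<in> T}" using Gc(2) by blast
    then have "genideal R (G N) \<subseteq> {y \<in> carrier R. y \<otimes> x \<in> T}"
      by (rule genideal_minimal[OF colon[OF \<open>x \<in> carrier R\<close>]])
    moreover have "a \<in> genideal R (G N)" using a Suc.prems(4) by blast
    ultimately show ?thesis using \<open>x \<in> carrier R\<close> m_comm by auto
  qed
  show ?case
    unfolding ideals_set_pow
  proof
    fix s assume "s \<in> ideal_prod R (J [^]\<^bsub>ideals_set R\<^esub> N) J"
    then show "s \<in> T" by induction (auto intro: step)
  qed
qed

context differential_ring
begin

text \<open>Sequences of divided derivatives, \<open>s k = (D ^^ k) (s 0) / k!\<close>.\<close>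

definition divided :: "(nat \<Rightarrow> 'a) \<Rightarrow> bool" where
  "divided s \<longleftrightarrow> (\<forall>k. s k \<in> carrier R \<and> D (s k) = [(Suc k)] \<cdot> s (Suc k))"

lemma D_zero: "D \<zero> = \<zero>"
proof -
  have "D \<zero> \<oplus> D \<zero> = D \<zero> \<oplus> \<zero>" using D_add[of \<zero> \<zero>] D_closed[of \<zero>] by simp
  then show ?thesis using D_closed[of \<zero>] add.l_cancel by (metis zero_closed)
qed

lemma D_one: "D \<one> = \<zero>"
proof -
  have "D \<one> \<oplus> D \<one> = D \<one> \<oplus> \<zero>" using D_mult[of \<one> \<one>] D_closed[of \<one>] by simp
  then show ?thesis using D_closed[of \<one>] add.l_cancel by (metis zero_closed one_closed)
qed

lemma D_pow_closed: "x \<in> carrier R \<Longrightarrow> (D ^^ k) x \<in> carrier R"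
  by (induction k) (auto simp: D_closed)

lemma D_add_pow: "x \<in> carrier R \<Longrightarrow> D ([(k::nat)] \<cdot> x) = [k] \<cdot> D x"
  by (induction k) (simp_all add: D_zero D_add D_closed)

lemma D_finsum: "f \<in> A \<rightarrow> carrier R \<Longrightarrow> D (\<Oplus>i\<in>A. f i) = (\<Oplus>i\<in>A. D (f i))"
  by (induction A rule: infinite_finite_induct)
    (auto simp: D_zero D_add D_closed Pi_def)

lemma divided_closed: "divided s \<Longrightarrow> s k \<in> carrier R"
  by (simp add: divided_def)

lemma divided_D_pow: "divided s \<Longrightarrow> [(fact k :: nat)] \<cdot> s k = (D ^^ k) (s 0)"
proof (induction k)
  case 0
  then show ?case by (simp add: divided_closed)
next
  case (Suc k)
  have "(D ^^ Suc k) (s 0) = D ([(fact k :: nat)] \<cdot> s k)" using Suc by simp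
  also have "\<dots> = [(fact k :: nat)] \<cdot> ([(Suc k)] \<cdot> s (Suc k))"
    using Suc.prems by (simp add: D_add_pow divided_closed) (simp add: divided_def)
  also have "\<dots> = [(fact (Suc k) :: nat)] \<cdot> s (Suc k)"
    using divided_closed[OF Suc.prems] by (simp only: add.nat_pow_pow fact_Suc of_nat_id)
  finally show ?case ..
qed

lemma divided_one: "divided (\<lambda>k. if k = 0 then \<one> else \<zero>)"
  by (auto simp: divided_def D_zero D_one)

text \<open>The Leibniz rule without binomial coefficients: in the derivative,
  \<open>s l \<otimes> r (Suc k - l)\<close> occurs \<open>l\<close> times from differentiating the
  first factor and \<open>Suc k - l\<close> times from the second, together \<open>Suc k\<close>
  times.\<close>

lemma divided_conv:
  assumes s: "divided s" and r: "divided r"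
  shows "divided (\<lambda>k. \<Oplus>l\<in>{..k}. s l \<otimes> r (k - l))"
proof -
  note [simp] = divided_closed[OF s] divided_closed[OF r]
  have Ds: "D (s k) = [(Suc k)] \<cdot> s (Suc k)" and Dr: "D (r k) = [(Suc k)] \<cdot> r (Suc k)" for k
    using s r by (auto simp: divided_def)
  show ?thesis
    unfolding divided_def
  proof (intro allI conjI)
    fix k
    show "(\<Oplus>l\<in>{..k}. s l \<otimes> r (k - l)) \<in> carrier R" by (auto intro: finsum_closed)
    define f where "f l = s l \<otimes> r (Suc k - l)" for l
    have [simp]: "f l \<in> carrier R" for l by (simp add: f_def)
    have "D (\<Oplus>l\<in>{..k}. s l \<otimes> r (k - l)) = (\<Oplus>l\<in>{..k}. D (s l \<otimes> r (k - l)))"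
      by (intro D_finsum) auto
    also have "\<dots> = (\<Oplus>l\<in>{..k}. [(Suc l)] \<cdot> f (Suc l) \<oplus> [(Suc k - l)] \<cdot> f l)"
    proof (intro finsum_cong' refl)
      fix l assume "l \<in> {..k}"
      then show "D (s l \<otimes> r (k - l)) = [(Suc l)] \<cdot> f (Suc l) \<oplus> [(Suc k - l)] \<cdot> f l"
        by (simp only: D_mult divided_closed[OF s] divided_closed[OF r] Ds Dr f_def
            add_pow_ldistr add_pow_rdistr diff_Suc_Suc Suc_diff_le atMost_iff)
    qed auto
    also have "\<dots> = (\<Oplus>l\<in>{..k}. [(Suc l)] \<cdot> f (Suc l)) \<oplus> (\<Oplus>l\<in>{..k}. [(Suc k - l)] \<cdot> f l)"
      by (intro finsum_addf) auto
    also have "(\<Oplus>l\<in>{..k}. [(Suc l)] \<cdot> f (Suc l)) = (\<Oplus>l\<in>{..Suc k}. [l] \<cdot> f l)"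
      by (subst finsum_Suc2) (auto simp del: add.nat_pow_Suc)
    also have "(\<Oplus>l\<in>{..k}. [(Suc k - l)] \<cdot> f l) = (\<Oplus>l\<in>{..Suc k}. [(Suc k - l)] \<cdot> f l)"
      by (subst finsum_Suc) auto
    also have "(\<Oplus>l\<in>{..Suc k}. [l] \<cdot> f l) \<oplus> (\<Oplus>l\<in>{..Suc k}. [(Suc k - l)] \<cdot> f l)
        = (\<Oplus>l\<in>{..Suc k}. [l] \<cdot> f l \<oplus> [(Suc k - l)] \<cdot> f l)"
      by (intro finsum_addf[symmetric]) auto
    also have "\<dots> = (\<Oplus>l\<in>{..Suc k}. [(Suc k)] \<cdot> f l)"
      by (intro finsum_cong' refl) (auto simp del: add.nat_pow_Suc simp add: add.nat_pow_mult)
    also have "\<dots> = [(Suc k)] \<cdot> (\<Oplus>l\<in>{..Suc k}. f l)"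
    proof -
      have m: "[(Suc k)] \<cdot> x = ([(Suc k)] \<cdot> \<one>) \<otimes> x" if "x \<in> carrier R" for x
        using that by (simp only: add_pow_ldistr one_closed l_one)
      have "(\<Oplus>l\<in>{..Suc k}. [(Suc k)] \<cdot> f l) = (\<Oplus>l\<in>{..Suc k}. ([(Suc k)] \<cdot> \<one>) \<otimes> f l)"
        by (intro finsum_cong' refl m) auto
      also have "\<dots> = ([(Suc k)] \<cdot> \<one>) \<otimes> (\<Oplus>l\<in>{..Suc k}. f l)"
        by (intro finsum_rdistr[symmetric]) auto
      also have "\<dots> = [(Suc k)] \<cdot> (\<Oplus>l\<in>{..Suc k}. f l)"
        by (intro m[symmetric] finsum_closed) auto
      finally show ?thesis .
    qed
    finally show "D (\<Oplus>l\<in>{..k}. s l \<otimes> r (k - l)) = [(Suc k)] \<cdot> (\<Oplus>l\<in>{..Suc k}. s l \<otimes> r (Suc k - l))"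
      by (simp only: f_def)
  qed
qed

lemma divided_exists:
  assumes inv: "\<And>k::nat. 0 < k \<Longrightarrow> [k] \<cdot> \<one> \<in> Units R" and z: "z \<in> carrier R"
  shows "\<exists>s. divided s \<and> s 0 = z"
proof -
  define s where "s = rec_nat z (\<lambda>k x. inv ([(Suc k)] \<cdot> \<one>) \<otimes> D x)"
  have s0: "s 0 = z" and sS: "s (Suc k) = inv ([(Suc k)] \<cdot> \<one>) \<otimes> D (s k)" for k
    by (simp_all add: s_def)
  have c: "s k \<in> carrier R" for k
    by (induction k) (use z inv[of "Suc _"] in \<open>auto simp: s0 sS D_closed simp del: add.nat_pow_Suc\<close>)
  have "D (s k) = [(Suc k)] \<cdot> s (Suc k)" for k
  proof -
    have u: "[(Suc k)] \<cdot> \<one> \<in> Units R" using inv by blast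
    have "[(Suc k)] \<cdot> s (Suc k) = ([(Suc k)] \<cdot> \<one>) \<otimes> s (Suc k)"
      using c by (simp only: add_pow_ldistr one_closed l_one)
    also have "\<dots> = D (s k)"
      using u c D_closed unfolding sS by (simp add: m_assoc[symmetric] del: add.nat_pow_Suc)
    finally show ?thesis ..
  qed
  with c s0 show ?thesis by (auto simp: divided_def)
qed

end

section \<open>Transfer to the differential algebra\<close>

lemma (in differential_ring) derivatives_closed:
  "I \<subseteq> carrier R \<Longrightarrow> {(D ^^ k) x | k x. k \<le> h \<and> x \<in> I} \<subseteq> carrier R"
  using D_pow_closed by auto

lemma (in differential_ring) deriv_ideal_is_ideal:
  "I \<subseteq> carrier R \<Longrightarrow> ideal (deriv_ideal R D I h) R"
  unfolding deriv_ideal_def by (rule genideal_ideal[OF derivatives_closed])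

lemma (in ring) unit_mult_in_idealD:
  assumes "ideal T R" "u \<in> Units R" "x \<in> carrier R" "u \<otimes> x \<in> T"
  shows "x \<in> T"
proof -
  have "inv u \<otimes> (u \<otimes> x) \<in> T" using ideal.I_l_closed[OF assms(1,4)] assms(2) by simp
  also have "inv u \<otimes> (u \<otimes> x) = (inv u \<otimes> u) \<otimes> x"
    using assms by (intro m_assoc[symmetric]) auto
  finally show ?thesis using assms by simp
qed

text \<open>Positive integers are invertible in \<open>K\<close>, and the structure map carries
  their inverses to the algebra.\<close>

lemma (in differential_algebra) nat_unit:
  assumes "char_zero K" "0 < (k :: nat)"
  shows "[k] \<cdot>\<^bsub>A\<^esub> \<one>\<^bsub>A\<^esub> \<in> Units A"
proof -
  define c where "c = [k] \<cdot>\<^bsub>K\<^esub> \<one>\<^bsub>K\<^esub>"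
  have "c \<in> Units K"
    using assms base.field_Units by (auto simp: c_def char_zero_def)
  then obtain c' where c: "c \<in> carrier K" "c' \<in> carrier K" "c \<otimes>\<^bsub>K\<^esub> c' = \<one>\<^bsub>K\<^esub>" "c' \<otimes>\<^bsub>K\<^esub> c = \<one>\<^bsub>K\<^esub>"
    by (auto simp: Units_def)
  have "[j] \<cdot>\<^bsub>A\<^esub> \<one>\<^bsub>A\<^esub> = ([j] \<cdot>\<^bsub>K\<^esub> \<one>\<^bsub>K\<^esub>) \<odot>\<^bsub>A\<^esub> \<one>\<^bsub>A\<^esub>" for j :: nat
    by (induction j) (simp_all add: smult_l_null smult_l_distr)
  then have k: "[k] \<cdot>\<^bsub>A\<^esub> \<one>\<^bsub>A\<^esub> = c \<odot>\<^bsub>A\<^esub> \<one>\<^bsub>A\<^esub>" by (simp add: c_def)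
  have "(a \<odot>\<^bsub>A\<^esub> \<one>\<^bsub>A\<^esub>) \<otimes>\<^bsub>A\<^esub> (b \<odot>\<^bsub>A\<^esub> \<one>\<^bsub>A\<^esub>) = (a \<otimes>\<^bsub>K\<^esub> b) \<odot>\<^bsub>A\<^esub> \<one>\<^bsub>A\<^esub>"
    if "a \<in> carrier K" "b \<in> carrier K" for a b
    using that by (simp add: smult_assoc2 smult_assoc1)
  with c have "(c' \<odot>\<^bsub>A\<^esub> \<one>\<^bsub>A\<^esub>) \<otimes>\<^bsub>A\<^esub> (c \<odot>\<^bsub>A\<^esub> \<one>\<^bsub>A\<^esub>) = \<one>\<^bsub>A\<^esub>"
      "(c \<odot>\<^bsub>A\<^esub> \<one>\<^bsub>A\<^esub>) \<otimes>\<^bsub>A\<^esub> (c' \<odot>\<^bsub>A\<^esub> \<one>\<^bsub>A\<^esub>) = \<one>\<^bsub>A\<^esub>"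
    by (simp_all add: smult_one)
  with c show ?thesis unfolding k Units_def by auto
qed

text \<open>Multiplying generating series convolves their coefficient sequences, so
  \<open>divided_conv\<close> applies factor by factor.\<close>

lemma (in cring) divided_poly_eval:
  assumes "differential_ring R D" and \<phi>: "\<And>v. \<phi> v \<in> carrier R"
    and s: "\<And>t. differential_ring.divided R D (\<lambda>l. \<phi> (t, l))"
  shows "differential_ring.divided R D (\<lambda>k. poly_eval \<phi> (fps_nth (\<Prod>i<(m::nat). series (\<alpha> i)) k))"
proof -
  interpret differential_ring R D by fact
  show ?thesis
  proof (induction m)
    case 0
    have "(\<lambda>k. poly_eval \<phi> (fps_nth (\<Prod>i<0. series (\<alpha> i)) k)) = (\<lambda>k. if k = 0 then \<one> else \<zero>)"
      using \<phi> by (intro ext) simp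
    then show ?case using divided_one by simp
  next
    case (Suc m)
    have "poly_eval \<phi> (fps_nth (\<Prod>i<Suc m. series (\<alpha> i)) k)
        = (\<Oplus>l\<in>{..k}. poly_eval \<phi> (fps_nth (\<Prod>i<m. series (\<alpha> i)) l) \<otimes> \<phi> (\<alpha> m, k - l))" for k
      using \<phi> by (simp add: fps_mult_nth poly_eval_sum poly_eval_mult series_def atLeast0AtMost)
    then show ?case using divided_conv[OF Suc s[of "\<alpha> m"]] by simp
  qed
qed

theorem corollary5p4:
  fixes K :: "('k, 'm) ring_scheme" and dK :: "'k \<Rightarrow> 'k"
    and A :: "('k, 'a, 'n) module_scheme" and dA :: "'a \<Rightarrow> 'a"
    and n :: nat and h :: "nat \<Rightarrow> nat" and H :: nat and I :: "nat \<Rightarrow> 'a set"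
  assumes "differential_algebra K dK A dA"
    and "char_zero K"
    and "n \<ge> 1"
    and "H = (\<Sum>i=1..n. h i)"
    and "\<And>i. i \<in> {1..n} \<Longrightarrow> ideal (I i) A"
  shows "(\<Inter>i\<in>{1..n}. deriv_ideal A dA (I i) (h i))
           [^]\<^bsub>ideals_set A\<^esub> (n * Max ((\<lambda>i. (h i + 1) * (H - h i)) ` {1..n}) + n)
         \<subseteq> deriv_ideal A dA (\<Inter>i\<in>{1..n}. I i) H"
proof -
  interpret differential_algebra K dK A dA by fact
  have DR: "differential_ring A dA" by unfold_locales
  \<comment> \<open>One more than the maximum, so that the exponent is \<open>n * d\<close> and
    \<open>d\<close> satisfies the strict bounds of \<open>prod_in_polar_jets\<close>.\<close>
  define d where "d = Suc (Max ((\<lambda>i. (h i + 1) * (H - h i)) ` {1..n}))"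
  define h' where "h' i = h (Suc i)" for i
  define J where "J = (\<Inter>i\<in>{1..n}. deriv_ideal A dA (I i) (h i))"
  define T where "T = deriv_ideal A dA (\<Inter>i\<in>{1..n}. I i) H"
  \<comment> \<open>The \<open>n * d\<close> factors of the power are split into \<open>n\<close>
    blocks of length \<open>d\<close>; block \<open>i\<close> uses the derivatives generating the
    ideal with index \<open>Suc i\<close>.\<close>
  define G where "G t = {(dA ^^ k) x | k x. k \<le> h' (t div d) \<and> x \<in> I (Suc (t div d))}" for t
  have H: "H = (\<Sum>i<n. h' i)"
    by (simp add: assms(4) h'_def sum.atLeast1_atMost_eq)
  have I: "I (Suc i) \<subseteq> carrier A" if "i < n" for i
    using assms(5)[of "Suc i"] that by (auto dest: ideal.Icarr)
  have d: "(h' i + 1) * ((\<Sum>l<n. h' l) - h' i) < d" if "i < n" for i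
  proof -
    have "(h (Suc i) + 1) * (H - h (Suc i)) \<le> Max ((\<lambda>i. (h i + 1) * (H - h i)) ` {1..n})"
      by (rule Max_ge[OF _ imageI]) (use that in auto)
    then show ?thesis by (simp add: d_def h'_def H)
  qed
  have idx: "t div d < n" if "t < n * d" for t
    using that by (simp add: less_mult_imp_div_less)
  have I1: "(\<Inter>i\<in>{1..n}. I i) \<subseteq> carrier A"
    using I[of 0] assms(3) by fastforce
  have T: "ideal T A" unfolding T_def by (rule deriv_ideal_is_ideal[OF I1])
  interpret T: ideal T A by (rule T)
  have "J [^]\<^bsub>ideals_set A\<^esub> (n * d) \<subseteq> T"
  proof (rule pow_ideal_subset[where G = G, OF _ T])
    have "J \<subseteq> deriv_ideal A dA (I 1) (h 1)" using assms(3) by (auto simp: J_def)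
    also have "\<dots> \<subseteq> carrier A"
      using deriv_ideal_is_ideal[OF I[of 0], of "h 1"] assms(3) by (auto dest: ideal.Icarr)
    finally show "J \<subseteq> carrier A" .
    show "\<forall>t<n * d. G t \<subseteq> carrier A"
      using derivatives_closed[OF I[OF idx]] unfolding G_def by blast
    show "\<forall>t<n * d. J \<subseteq> genideal A (G t)"
    proof (intro allI impI)
      fix t assume "t < n * d"
      then have "Suc (t div d) \<in> {1..n}" using idx[of t] by (simp add: Suc_le_eq)
      then show "J \<subseteq> genideal A (G t)"
        unfolding J_def G_def deriv_ideal_def h'_def by blast
    qed
    show "\<forall>g. (\<forall>t<n * d. g t \<in> G t) \<longrightarrow> finprod A g {..<n * d} \<in> T"
    proof (intro allI impI)
      fix g assume g: "\<forall>t<n * d. g t \<in> G t"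
      have "\<forall>t. \<exists>k s. divided s \<and> k \<le> h' (t div d) \<and>
          (t < n * d \<longrightarrow> s 0 \<in> I (Suc (t div d)) \<and> g t = (dA ^^ k) (s 0))"
      proof
        fix t
        show "\<exists>k s. divided s \<and> k \<le> h' (t div d) \<and>
          (t < n * d \<longrightarrow> s 0 \<in> I (Suc (t div d)) \<and> g t = (dA ^^ k) (s 0))"
        proof (cases "t < n * d")
          case True
          then obtain k x where kx: "k \<le> h' (t div d)" "x \<in> I (Suc (t div d))" "g t = (dA ^^ k) x"
            using g by (auto simp: G_def)
          have "x \<in> carrier A" using kx(2) I[OF idx[OF True]] by blast
          then obtain s where "divided s" "s 0 = x"
            using divided_exists[OF nat_unit[OF assms(2)]] by blast
          then show ?thesis using kx by blast
        next
          case False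
          \<comment> \<open>Beyond \<open>n * d\<close> any divided sequence serves, so that
            \<open>\<phi>\<close> takes values in the carrier everywhere.\<close>
          obtain s where "divided s"
            using divided_exists[OF nat_unit[OF assms(2)], of "\<zero>\<^bsub>A\<^esub>"] by auto
          then show ?thesis using False by blast
        qed
      qed
      then obtain k s where s: "\<And>t. divided (s t)"
        and k: "\<And>t. k t \<le> h' (t div d)"
        and s0: "\<And>t. t < n * d \<Longrightarrow> s t 0 \<in> I (Suc (t div d))"
        and gt: "\<And>t. t < n * d \<Longrightarrow> g t = (dA ^^ k t) (s t 0)"
        by metis
      define \<phi> where "\<phi> = (\<lambda>(t, l). s t l)"
      have sc: "s t l \<in> carrier A" for t l
        using divided_closed[OF s] .
      have \<phi>: "\<phi> v \<in> carrier A" for v by (cases v) (simp add: \<phi>_def sc)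
      note [simp] = poly_eval_closed[of \<phi>, OF \<phi>]
      have scale: "[c] \<cdot>\<^bsub>A\<^esub> x = ([c] \<cdot>\<^bsub>A\<^esub> \<one>\<^bsub>A\<^esub>) \<otimes>\<^bsub>A\<^esub> x" if "x \<in> carrier A" for c :: nat and x
        using that add_pow_ldistr[of "\<one>\<^bsub>A\<^esub>" x c] by simp
      have gen: "poly_eval \<phi> (fps_nth (\<Prod>i<n. series (\<alpha> i)) j) \<in> T"
        if j: "j < Suc H" and \<alpha>: "\<forall>i<n. \<alpha> i \<in> {i * d..<i * d + d}" for \<alpha> j
      proof -
        define E where "E j = poly_eval \<phi> (fps_nth (\<Prod>i<n. series (\<alpha> i)) j)" for j
        have Ec: "E j \<in> carrier A" for j by (simp add: E_def)
        have E: "divided E"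
          unfolding E_def by (rule divided_poly_eval[OF DR \<phi>]) (simp add: \<phi>_def s)
        \<comment> \<open>\<open>E 0\<close> is a product with one element from each ideal, as
          \<open>\<alpha> i\<close> lies in block \<open>i\<close>.\<close>
        have "E 0 \<in> I (Suc i)" if "i < n" for i
        proof -
          interpret Ii: ideal "I (Suc i)" A using assms(5)[of "Suc i"] that by simp
          have lt: "i * d \<le> \<alpha> i" "\<alpha> i < i * d + d" using \<alpha> that by auto
          then have "\<alpha> i div d = i" by (simp add: div_nat_eqI mult.commute)
          moreover have "\<alpha> i < n * d"
          proof -
            have "i * d + d \<le> n * d" using mult_le_mono1[of "Suc i" n d] that by simp
            then show ?thesis using lt by linarith
          qed
          ultimately have "s (\<alpha> i) 0 \<in> I (Suc i)" using s0[of "\<alpha> i"] by simp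
          moreover have "E 0 = s (\<alpha> i) 0 \<otimes>\<^bsub>A\<^esub> poly_eval \<phi> (\<Prod>l\<in>{..<n} - {i}. zvar (\<alpha> l, 0))"
            using that \<phi> prod.remove[of "{..<n}" i "\<lambda>l. zvar (\<alpha> l, 0::nat)"]
            by (simp add: E_def fps_prod_nth_0 series_def poly_eval_mult) (simp add: \<phi>_def)
          ultimately show ?thesis by (simp add: Ii.I_r_closed)
        qed
        then have "E 0 \<in> (\<Inter>i\<in>{1..n}. I i)"
          by (auto simp: Suc_le_eq gr0_conv_Suc)
        \<comment> \<open>Up to the unit \<open>fact j\<close>, \<open>E j\<close> is the
          \<open>j\<close>-th derivative of \<open>E 0\<close>, with
          \<open>j \<le> H\<close>.\<close>
        then have "(dA ^^ j) (E 0) \<in> {(dA ^^ k) x | k x. k \<le> H \<and> x \<in> (\<Inter>i\<in>{1..n}. I i)}"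
          using j unfolding less_Suc_eq_le by blast
        then have "(dA ^^ j) (E 0) \<in> T"
          unfolding T_def deriv_ideal_def using genideal_self[OF derivatives_closed[OF I1]] by blast
        then have "([(fact j :: nat)] \<cdot>\<^bsub>A\<^esub> \<one>\<^bsub>A\<^esub>) \<otimes>\<^bsub>A\<^esub> E j \<in> T"
          using divided_D_pow[OF E, of j] scale[OF Ec] by simp
        then have "E j \<in> T"
          by (rule unit_mult_in_idealD[OF T nat_unit[OF assms(2) fact_gt_zero] Ec])
        then show ?thesis by (simp add: E_def)
      qed
      have "of_nat (fact d ^ n) * (\<Prod>t<n * d. zvar (t, k t)) \<in> polar_jets n d (Suc H)"
        unfolding H
      proof (rule prod_in_polar_jets[OF _ d])
        fix i t assume "i < n" "t \<in> {i * d..<i * d + d}"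
        then have "t div d = i" by (simp add: div_nat_eqI mult.commute)
        then show "k t \<le> h' i" using k[of t] by simp
      qed
      then have "poly_eval \<phi> (of_nat (fact d ^ n) * (\<Prod>t<n * d. zvar (t, k t))) \<in> T"
        unfolding polar_jets_def by (rule poly_eval_span[OF \<phi> T, rotated]) (use gen in auto)
      also have "poly_eval \<phi> (of_nat (fact d ^ n) * (\<Prod>t<n * d. zvar (t, k t)))
          = ([(fact d ^ n :: nat)] \<cdot>\<^bsub>A\<^esub> \<one>\<^bsub>A\<^esub>) \<otimes>\<^bsub>A\<^esub> finprod A (\<lambda>t. s t (k t)) {..<n * d}"
        using \<phi> by (simp only: poly_eval_mult poly_eval_of_nat poly_eval_prod poly_eval_zvar)
          (simp add: \<phi>_def)
      finally have P: "finprod A (\<lambda>t. s t (k t)) {..<n * d} \<in> T"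
        by (rule unit_mult_in_idealD[OF T nat_unit[OF assms(2) zero_less_power[OF fact_gt_zero]]
              finprod_closed, rotated]) (simp add: sc)
      \<comment> \<open>Ordinary derivatives are factorials times divided ones, so this product is a
        multiple of the one in \<open>P\<close>.\<close>
      have "finprod A g {..<n * d}
          = finprod A (\<lambda>t. ([(fact (k t) :: nat)] \<cdot>\<^bsub>A\<^esub> \<one>\<^bsub>A\<^esub>) \<otimes>\<^bsub>A\<^esub> s t (k t)) {..<n * d}"
        using divided_D_pow[OF s]
        by (intro finprod_cong' refl) (auto simp: gt sc D_pow_closed simp flip: scale)
      also have "\<dots> = finprod A (\<lambda>t. [(fact (k t) :: nat)] \<cdot>\<^bsub>A\<^esub> \<one>\<^bsub>A\<^esub>) {..<n * d}
          \<otimes>\<^bsub>A\<^esub> finprod A (\<lambda>t. s t (k t)) {..<n * d}"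
        by (intro finprod_multf) (auto simp: sc)
      also have "\<dots> \<in> T"
        using P by (intro T.I_l_closed finprod_closed) auto
      finally show "finprod A g {..<n * d} \<in> T" .
    qed
  qed
  then show ?thesis by (simp add: J_def T_def d_def algebra_simps)
qed

end
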